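(* Let $x=(x_1,\dots,x_n)$ and $m$ a nonnegative integer. Then \[ \sum_{\substack{\lambda\\ \lambda_1\le m}}h^{(m)}_\lambda(t_2;t)P_\lambda(x;t)=(x_1\cdots x_n)^{m/2}P^{(B_n)}_{(m/2)^n}(x;t,t_2). \]
   Context: $(a;t)_k=\prod_{j=0}^{k-1}(1-at^j)$. $P_\lambda(x;t)$ is the Hall–Littlewood polynomial $\frac{1}{v_\lambda(t)}\sum_{w\in S_n}w\big(x^\lambda\prod_{i<j}\frac{x_i-tx_j}{x_i-x_j}\big)$ with $v_\lambda(t)=\prod_{i\ge0}(t;t)_{m_i(\lambda)}/(1-t)^{m_i(\lambda)}$, $m_i(\lambda)$ the multiplicity of $i$, $m_0(\lambda)=n-\ell(\lambda)$. Rogers–Szegő: $H_k(z;q)=\sum_{j=0}^kz^j\frac{(q;q)_k}{(q;q)_j(q;q)_{k-j}}$; $h^{(m)}_\lambda(t_2;t)=\prod_{i=1}^{m-1}H_{m_i(\lambda)}(-t_2;t)$. $(m/2)^n=(m/2,\dots,m/2)$ is a partition ($m$ even) or a half-partition (all parts in $\frac12+\mathbb{Z}$). For $\lambda$ a partition of length $\le n$ or a half-partition of length $n$, \[P^{(B_n)}_\lambda(x;t,t_2)=\frac{1}{(-t_2;t)_{n-\ell(\lambda)}v_\lambda(t)}\sum_{w\in W}w\Big(x^{-\lambda}\prod_{i=1}^n\frac{1-t_2x_i}{1-x_i}\prod_{i<j}\frac{(tx_i-x_j)(1-tx_ix_j)}{(x_i-x_j)(1-x_ix_j)}\Big),\]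 where $W$ is the hyperoctahedral group (permutations and inversions $x_i\mapsto x_i^{-1}$), a half-partition has length $n$, and for half-partitions $v_\lambda(t)=\prod_{i}(t;t)_{m_i(\lambda)}/(1-t)^{m_i(\lambda)}$ with the product over positive half-odd-integers $i$. *)

theory Defs
  imports Complex_Main "HOL-Combinatorics.Permutations"
begin

text \<open>
  Conventions. Identities between rational functions in $x_1,\dots,x_n$ are expressed by evaluation
  at arbitrary points of an arbitrary field of characteristic 0 at which no denominator vanishes;
  since the field is arbitrary, this includes points with indeterminate coordinates.
  Variables are indexed by \<open>{..<n}\<close>. A group element \<open>w\<close> acts on a function \<open>f\<close> of the variables
  by substitution.

  A partition with at most \<open>n\<close> parts is the weakly decreasing list of length exactly \<open>n\<close> obtained
  by padding with zeros, so that \<open>count_list \<mu> 0 = n - \<ell>(\<mu>)\<close>. Partitions and half-partitions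
  are treated uniformly as lists over a type of numbers.
\<close>

definition qpoch :: "'a::comm_ring_1 \<Rightarrow> 'a \<Rightarrow> nat \<Rightarrow> 'a" where
  "qpoch a t k = (\<Prod>j<k. 1 - a * t ^ j)"

definition partitions_in_box :: "nat \<Rightarrow> nat \<Rightarrow> nat list set" where
  "partitions_in_box n m = {\<mu>. length \<mu> = n \<and> sorted_wrt (\<ge>) \<mu> \<and> (\<forall>i\<in>set \<mu>. i \<le> m)}"

definition part_length :: "'b::zero list \<Rightarrow> nat" where
  "part_length \<mu> = length (filter (\<lambda>i. i \<noteq> 0) \<mu>)"

text \<open>The product over all \<open>i\<close> reduces to the \<open>i\<close> that occur in the zero-padded list (including
  \<open>i = 0\<close> for partitions), because the factor for multiplicity 0 is 1.\<close>

definition v_part :: "'b list \<Rightarrow> 'a::field \<Rightarrow> 'a" where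
  "v_part \<mu> t = (\<Prod>i\<in>set \<mu>. qpoch t t (count_list \<mu> i) / (1 - t) ^ count_list \<mu> i)"

definition HL_kernel :: "nat \<Rightarrow> nat list \<Rightarrow> 'a::field \<Rightarrow> (nat \<Rightarrow> 'a) \<Rightarrow> 'a" where
  "HL_kernel n \<mu> t x =
     (\<Prod>i<n. x i ^ (\<mu> ! i)) * (\<Prod>j<n. \<Prod>i<j. (x i - t * x j) / (x i - x j))"

definition hall_littlewood :: "nat \<Rightarrow> nat list \<Rightarrow> (nat \<Rightarrow> 'a::field) \<Rightarrow> 'a \<Rightarrow> 'a" where
  "hall_littlewood n \<mu> x t =
     1 / v_part \<mu> t * (\<Sum>w | w permutes {..<n}. HL_kernel n \<mu> t (x \<circ> w))"

definition rogers_szego :: "nat \<Rightarrow> 'a::field \<Rightarrow> 'a \<Rightarrow> 'a" where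
  "rogers_szego k z q = (\<Sum>j\<le>k. z ^ j * (qpoch q q k / (qpoch q q j * qpoch q q (k - j))))"

definition h_part :: "nat \<Rightarrow> nat list \<Rightarrow> 'a::field \<Rightarrow> 'a \<Rightarrow> 'a" where
  "h_part m \<mu> t2 t = (\<Prod>i\<in>{1..<m}. rogers_szego (count_list \<mu> i) (- t2) t)"

text \<open>For $e \in \frac12\mathbb{Z}$ and $r = x^{1/2}$, the power $x^e$ is $r^{2e}$. Half-integral
  powers of the variables \<open>x i\<close> are expressed through chosen square roots \<open>r i\<close>.\<close>

definition half_pow :: "'a::field \<Rightarrow> rat \<Rightarrow> 'a" where
  "half_pow r e = r powi \<lfloor>2 * e\<rfloor>"

text \<open>The pair \<open>(\<sigma>, S)\<close> stands for the substitution that replaces the \<open>i\<close>-th variable by the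
  \<open>\<sigma> i\<close>-th one, inverted if \<open>i \<in> S\<close>. On square roots this is the action compatible with the one
  on the \<open>x i\<close>.\<close>

definition hyperoctahedral :: "nat \<Rightarrow> ((nat \<Rightarrow> nat) \<times> nat set) set" where
  "hyperoctahedral n = {\<sigma>. \<sigma> permutes {..<n}} \<times> Pow {..<n}"

definition hyperoctahedral_act ::
    "(nat \<Rightarrow> nat) \<times> nat set \<Rightarrow> (nat \<Rightarrow> 'a::field) \<Rightarrow> nat \<Rightarrow> 'a" where
  "hyperoctahedral_act w r = (\<lambda>i. if i \<in> snd w then inverse (r (fst w i)) else r (fst w i))"

definition PB_kernel :: "nat \<Rightarrow> rat list \<Rightarrow> 'a::field \<Rightarrow> 'a \<Rightarrow> (nat \<Rightarrow> 'a) \<Rightarrow> 'a" where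
  "PB_kernel n \<mu> t t2 r =
     (let x = (\<lambda>i. (r i)\<^sup>2) in
       (\<Prod>i<n. half_pow (r i) (- (\<mu> ! i)))
       * (\<Prod>i<n. (1 - t2 * x i) / (1 - x i))
       * (\<Prod>j<n. \<Prod>i<j. ((t * x i - x j) * (1 - t * x i * x j))
                         / ((x i - x j) * (1 - x i * x j))))"

text \<open>$P^{(B_n)}_\mu(x;t,t_2)$ at the point with coordinates $x_i = r_i^2$.\<close>

definition PB :: "nat \<Rightarrow> rat list \<Rightarrow> (nat \<Rightarrow> 'a::field) \<Rightarrow> 'a \<Rightarrow> 'a \<Rightarrow> 'a" where
  "PB n \<mu> r t t2 =
     1 / (qpoch (- t2) t (n - part_length \<mu>) * v_part \<mu> t)
     * (\<Sum>w\<in>hyperoctahedral n. PB_kernel n \<mu> t t2 (hyperoctahedral_act w r))"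

end

theory Submission
  imports Defs "HOL-Combinatorics.Multiset_Permutations" "HOL-Computational_Algebra.Polynomial"
begin

text \<open>
  Functions of finite sets of variables form an associative algebra under
  $(f * g)(A) = \sum_{B \subseteq A} f(B)\, g(A \setminus B)
  \prod_{i \in B,\, j \in A \setminus B} \frac{x_i - t x_j}{x_i - x_j}$.
  Splitting a partition at its largest part writes the left-hand side as an iterated product of
  weights $x_B^k H_{|B|}(-t_2;t)$. Writing $E(A) = \prod_i \frac{1 - t_2 x_i}{1 - x_i}
  \prod_{i<j} \frac{1 - t x_i x_j}{1 - x_i x_j}$ and $D$ for $E$ at the inverted variables, the
  right-hand side is $F_m = (x^m D) * E$, up to the normalisation for $m = 0$.
  Let $Z(B) = (-t_2)^{|B|}$. Then $H = Z * 1$, so the claim follows by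
  induction on $m$ from $Z * F_0 = 1$ and $x D = x * Z * D$. The first identity comes from
  $D * E = (-t_2;t)_n$, which is proved by clearing denominators in one variable and counting roots.
  The second one reduces, via $x * Z = \prod_i (x_i - t_2)$, to $D_0 = 1 * (x^{-1} D_0)$ where
  $D_0$, $E_0$ are $D$, $E$ at $t_2 = 0$; it holds because $D_0 * E_0 = 1$ and because
  $D * E = 0$ at $t_2 = -1$ says that $(x^{-1} D_0) * E_0$ is the unit of the algebra.
\<close>

section \<open>Finite sums and polynomials\<close>

text \<open>The obstacle is that the weights are not uniform: levels 1 to m - 1 carry a Rogers-Szego
  factor, levels 0 and m carry none. The partial sums that keep the factor at their top level k are
  therefore not F_k but x^k Z * F_k, and that is the inductive statement. At the next level x^(k+1)
  H = x^(k+1) Z * x^(k+1), and the remainder x^(k+1) * x^k Z * F_k is F_(k+1). The target sum is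
  such a remainder at the last level.

  Two functions called 1 must be kept apart. In H = Z * 1, Z * F_0 = 1, D_0 * E_0 = 1 and D_0 = 1 *
  (...) it is the constant function; the unit of the algebra is 1 on the empty set and 0 elsewhere.
  Multiplication by a function such as x^k, multiplicative over disjoint unions, is an endomorphism
  of the algebra; this shifts the relation between D and x D to every level.

  The root counts vary one variable and fix the others as points of the field, so the candidate
  roots must be distinct. For the B-type sum they include x_l and 1/x_l, which coincide at the
  admissible value x_l = -1; hence the extra cases.\<close>

lemma sum_Pow_insert:
  assumes "finite A" "k \<notin> A"
  shows "(\<Sum>S\<in>Pow (insert k A). f S) = (\<Sum>S\<in>Pow A. f S + f (insert k S))"
proof -
  have "(\<Sum>S\<in>Pow (insert k A). f S) = (\<Sum>S\<in>Pow A. f S) + (\<Sum>S\<in>insert k ` Pow A. f S)"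
    unfolding Pow_insert using assms by (intro sum.union_disjoint) auto
  also have "(\<Sum>S\<in>insert k ` Pow A. f S) = (\<Sum>S\<in>Pow A. f (insert k S))"
    using assms(2) by (subst sum.reindex) (auto simp: inj_on_def)
  finally show ?thesis by (simp add: sum.distrib)
qed

lemma poly_eq_0_if_many_roots:
  fixes p :: "'a::idom poly"
  assumes "degree p \<le> d" "finite Z" "card Z > d" "\<And>z. z \<in> Z \<Longrightarrow> poly p z = 0"
  shows "p = 0"
proof (rule ccontr)
  assume "p \<noteq> 0"
  then have "card Z \<le> card {z. poly p z = 0}"
    using assms(4) by (intro card_mono) (auto simp: poly_roots_finite)
  also have "\<dots> \<le> degree p" by (rule card_poly_roots_bound[OF \<open>p \<noteq> 0\<close>])
  finally show False using assms(1,3) by simp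
qed

lemma degree_prod_le:
  fixes f :: "'b \<Rightarrow> 'a::comm_ring_1 poly"
  assumes "\<And>i. i \<in> A \<Longrightarrow> degree (f i) \<le> c"
  shows "degree (\<Prod>i\<in>A. f i) \<le> c * card A"
  using assms
proof (induction A rule: infinite_finite_induct)
  case (insert a A)
  then have "degree (f a * prod f A) \<le> c + c * card A"
    by (intro order.trans[OF degree_mult_le] add_mono) auto
  then show ?case using insert by simp
qed auto

text \<open>Both products are monic of the same degree, so their leading terms cancel and the factor
  X does not push the degree above \<open>card A\<close>. Without this saving the root count in
  \<open>hl_star_monomial_power\<close> would fail by one.\<close>

lemma degree_prod_diff_less:
  fixes a b :: "'b \<Rightarrow> 'a::comm_ring_1"
  assumes "finite A"
  shows "degree ([:0, 1:] * ((\<Prod>i\<in>A. [:a i, 1:]) - (\<Prod>i\<in>A. [:b i, 1:]))) \<le> card A"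
  using assms
proof (induction A rule: finite_induct)
  case (insert k A)
  let ?P = "\<Prod>i\<in>A. [:a i, 1:]" and ?Q = "\<Prod>i\<in>A. [:b i, 1:]" and ?X = "[:0, 1:] :: 'a poly"
  \<comment> \<open>Telescoping a P - b Q = a (P - Q) + (a - b) Q; the difference of the two monic
    linear factors is a constant.\<close>
  have eq: "?X * ([:a k, 1:] * ?P - [:b k, 1:] * ?Q)
      = [:a k, 1:] * (?X * (?P - ?Q)) + ([:a k, 1:] - [:b k, 1:]) * (?X * ?Q)"
    by (simp only: algebra_simps)
  have "degree ?Q \<le> 1 * card A" by (rule degree_prod_le) simp
  then have 1: "degree (([:a k, 1:] - [:b k, 1:]) * (?X * ?Q)) \<le> 0 + (1 + card A)"
    by (intro order.trans[OF degree_mult_le] add_mono) auto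
  have 2: "degree ([:a k, 1:] * (?X * (?P - ?Q))) \<le> 1 + card A"
    by (rule order.trans[OF degree_mult_le], rule add_mono, simp, rule insert.IH)
  show ?case
    unfolding prod.insert[OF insert(1,2)] eq card_insert_disjoint[OF insert(1,2)]
    using degree_add_le[OF 2, OF 1[unfolded add_0]] by (simp only: plus_1_eq_Suc)
qed simp

section \<open>The product on functions of finite sets\<close>

definition hl_cross :: "'a::field \<Rightarrow> ('i \<Rightarrow> 'a) \<Rightarrow> 'i set \<Rightarrow> 'i set \<Rightarrow> 'a" where
  "hl_cross t x B C = (\<Prod>i\<in>B. \<Prod>j\<in>C. (x i - t * x j) / (x i - x j))"

definition hl_star ::
    "'a::field \<Rightarrow> ('i \<Rightarrow> 'a) \<Rightarrow> ('i set \<Rightarrow> 'a) \<Rightarrow> ('i set \<Rightarrow> 'a) \<Rightarrow> 'i set \<Rightarrow> 'a" where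
  "hl_star t x f g A = (\<Sum>B\<in>Pow A. f B * g (A - B) * hl_cross t x B (A - B))"

lemma hl_cross_empty [simp]: "hl_cross t x {} C = 1" "hl_cross t x B {} = 1"
  by (simp_all add: hl_cross_def)

lemma hl_cross_Un_left:
  assumes "finite B" "finite B'" "B \<inter> B' = {}"
  shows "hl_cross t x (B \<union> B') C = hl_cross t x B C * hl_cross t x B' C"
  using assms by (simp add: hl_cross_def prod.union_disjoint)

lemma hl_cross_Un_right:
  assumes "finite C" "finite C'" "C \<inter> C' = {}"
  shows "hl_cross t x B (C \<union> C') = hl_cross t x B C * hl_cross t x B C'"
  using assms by (simp add: hl_cross_def prod.union_disjoint prod.distrib)

lemma hl_cross_insert_left:
  assumes "finite B" "k \<notin> B"
  shows "hl_cross t x (insert k B) C = (\<Prod>j\<in>C. (x k - t * x j) / (x k - x j)) * hl_cross t x B C"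
  using assms by (simp add: hl_cross_def)

lemma hl_cross_insert_right:
  assumes "finite C" "k \<notin> C"
  shows "hl_cross t x B (insert k C) = (\<Prod>i\<in>B. (x i - t * x k) / (x i - x k)) * hl_cross t x B C"
  using assms by (simp add: hl_cross_def flip: prod.distrib)

lemma hl_star_cong:
  assumes "\<And>B. B \<subseteq> A \<Longrightarrow> f B = f' B" "\<And>B. B \<subseteq> A \<Longrightarrow> g B = g' B"
  shows "hl_star t x f g A = hl_star t x f' g' A"
  unfolding hl_star_def using assms by (intro sum.cong) auto

lemma hl_star_unit_right:
  assumes "finite A"
  shows "hl_star t x f (\<lambda>B. if B = {} then 1 else 0) A = f A"
proof -
  have "hl_star t x f (\<lambda>B. if B = {} then 1 else 0) A = (\<Sum>B\<in>Pow A. if B = A then f A else 0)"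
    unfolding hl_star_def by (intro sum.cong) auto
  then show ?thesis using assms by simp
qed

text \<open>Both bracketings run over the ordered splittings of A into three disjoint blocks. In
  both, the weight is the product of the three pairwise cross factors, because
  \<open>hl_cross\<close> is multiplicative under disjoint unions in either argument.\<close>

lemma hl_star_assoc:
  assumes "finite A"
  shows "hl_star t x (hl_star t x f g) h A = hl_star t x f (hl_star t x g h) A"
proof -
  have fin: "finite B" if "B \<subseteq> A" for B using that assms by (rule finite_subset)
  have "hl_star t x (hl_star t x f g) h A =
      (\<Sum>(B, C)\<in>Sigma (Pow A) Pow. f C * g (B - C) * hl_cross t x C (B - C) * h (A - B) *
         hl_cross t x B (A - B))"
    unfolding hl_star_def sum_distrib_right using assms fin
    by (subst sum.Sigma) (auto simp: mult_ac)
  also have "\<dots> = (\<Sum>(C, B)\<in>Sigma (Pow A) (\<lambda>C. Pow (A - C)). f C * (g B * h (A - C - B) *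
         hl_cross t x B (A - C - B)) * hl_cross t x C (A - C))"
  proof (rule sum.reindex_bij_witness[where i = "\<lambda>(C, B). (C \<union> B, C)" and j = "\<lambda>(B, C). (C, B - C)"])
    fix p assume "p \<in> Sigma (Pow A) Pow"
    then obtain B C where p: "p = (B, C)" "C \<subseteq> B" "B \<subseteq> A" by auto
    have sets: "A - C - (B - C) = A - B" "A - C = (B - C) \<union> (A - B)" using p by auto
    have "hl_cross t x B (A - B) = hl_cross t x C (A - B) * hl_cross t x (B - C) (A - B)"
      using hl_cross_Un_left[of C "B - C" t x "A - B"] p fin by (simp add: Un_absorb1 finite_subset)
    moreover have "hl_cross t x C (A - C) = hl_cross t x C (B - C) * hl_cross t x C (A - B)"
      unfolding sets(2) using assms p fin by (intro hl_cross_Un_right) auto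
    ultimately show "(case case p of (B, C) \<Rightarrow> (C, B - C) of (C, B) \<Rightarrow>
          f C * (g B * h (A - C - B) * hl_cross t x B (A - C - B)) * hl_cross t x C (A - C)) =
        (case p of (B, C) \<Rightarrow> f C * g (B - C) * hl_cross t x C (B - C) * h (A - B) * hl_cross t x B (A - B))"
      by (simp add: p sets(1) mult_ac)
  qed auto
  also have "\<dots> = hl_star t x f (hl_star t x g h) A"
    unfolding hl_star_def sum_distrib_right sum_distrib_left using assms
    by (subst sum.Sigma) (auto simp: mult_ac)
  finally show ?thesis .
qed

text \<open>A product over elements satisfies c(A) = c(B) c(A - B), so it comes out of every
  summand. Applied below to monomials and to the product of \<open>x i - t2\<close>.\<close>

lemma hl_star_multiplicative:
  assumes "finite A"
  shows "hl_star t x (\<lambda>B. (\<Prod>i\<in>B. c i) * f B) (\<lambda>B. (\<Prod>i\<in>B. c i) * g B) A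
       = (\<Prod>i\<in>A. c i) * hl_star t x f g A"
  unfolding hl_star_def sum_distrib_left
proof (rule sum.cong)
  fix B assume "B \<in> Pow A"
  then have "(\<Prod>i\<in>A. c i) = (\<Prod>i\<in>A - B. c i) * (\<Prod>i\<in>B. c i)"
    using assms by (intro prod.subset_diff) auto
  then show "(\<Prod>i\<in>B. c i) * f B * ((\<Prod>i\<in>A - B. c i) * g (A - B)) * hl_cross t x B (A - B)
      = (\<Prod>i\<in>A. c i) * (f B * g (A - B) * hl_cross t x B (A - B))"
    by (simp add: mult_ac)
qed simp

text \<open>The product is triangular with respect to inclusion: the summand B = A is f A, because h
  is 1 on the empty set, and all other summands see f only on proper subsets.\<close>

lemma hl_star_right_cancel:
  assumes "finite U" "h {} = 1" "\<And>A. A \<subseteq> U \<Longrightarrow> hl_star t x f h A = hl_star t x g h A" "A \<subseteq> U"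
  shows "f A = g A"
proof -
  have "finite A" using assms(1,4) by (rule finite_subset[rotated])
  then show ?thesis using assms(4)
  proof (induction A rule: finite_psubset_induct)
    case (psubset A)
    have split: "hl_star t x u h A = u A + (\<Sum>B\<in>Pow A - {A}. u B * h (A - B) * hl_cross t x B (A - B))"
      for u unfolding hl_star_def using psubset.hyps assms(2)
      by (subst sum.remove[of _ A]) auto
    have "(\<Sum>B\<in>Pow A - {A}. f B * h (A - B) * hl_cross t x B (A - B))
        = (\<Sum>B\<in>Pow A - {A}. g B * h (A - B) * hl_cross t x B (A - B))"
      using psubset by (intro sum.cong) auto
    then show ?case using assms(3)[OF psubset.prems] by (simp add: split)
  qed
qed

section \<open>Products over unordered pairs of variables\<close>

definition pair_prod :: "'a::field \<Rightarrow> (nat \<Rightarrow> 'a) \<Rightarrow> nat set \<Rightarrow> 'a" where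
  "pair_prod t y A = (\<Prod>j\<in>A. \<Prod>i\<in>{i\<in>A. i < j}. (1 - t * (y i * y j)) / (1 - y i * y j))"

lemma pair_prod_empty [simp]: "pair_prod t y {} = 1"
  by (simp add: pair_prod_def)

text \<open>The factors are symmetric in i and j; the order of the indices only selects every
  unordered pair once. Hence k may sit anywhere in the order.\<close>

lemma pair_prod_insert:
  assumes "finite A" "k \<notin> A"
  shows "pair_prod t y (insert k A)
       = (\<Prod>j\<in>A. (1 - t * (y k * y j)) / (1 - y k * y j)) * pair_prod t y A"
proof -
  let ?f = "\<lambda>i j. (1 - t * (y i * y j)) / (1 - y i * y j)"
  have sym: "?f i j = ?f j i" for i j by (simp add: mult_ac)
  have 1: "(\<Prod>i\<in>{i\<in>insert k A. i < k}. ?f i k) = (\<Prod>j\<in>A. if j < k then ?f k j else 1)"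
  proof -
    have "{i\<in>insert k A. i < k} = {j\<in>A. j < k}" by auto
    then show ?thesis using assms by (simp add: prod.inter_filter[symmetric] sym[of _ k])
  qed
  have 2: "(\<Prod>i\<in>{i\<in>insert k A. i < j}. ?f i j)
      = (if k < j then ?f k j else 1) * (\<Prod>i\<in>{i\<in>A. i < j}. ?f i j)" for j
  proof -
    have "{i\<in>insert k A. i < j} = (if k < j then insert k {i\<in>A. i < j} else {i\<in>A. i < j})" by auto
    then show ?thesis using assms by auto
  qed
  have "pair_prod t y (insert k A) =
      (\<Prod>i\<in>{i\<in>insert k A. i < k}. ?f i k) * (\<Prod>j\<in>A. \<Prod>i\<in>{i\<in>insert k A. i < j}. ?f i j)"
    unfolding pair_prod_def using assms by simp
  also have "\<dots> = (\<Prod>j\<in>A. (if j < k then ?f k j else 1) * (if k < j then ?f k j else 1)) * pair_prod t y A"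
    unfolding 1 2 prod.distrib pair_prod_def by (simp only: mult_ac)
  also have "(\<Prod>j\<in>A. (if j < k then ?f k j else 1) * (if k < j then ?f k j else 1)) = (\<Prod>j\<in>A. ?f k j)"
    using assms(2) by (intro prod.cong) (auto simp: not_less_iff_gr_or_eq)
  finally show ?thesis .
qed

lemma pair_prod_Un:
  assumes "finite B" "finite C" "B \<inter> C = {}"
  shows "pair_prod t y (B \<union> C) = pair_prod t y B * pair_prod t y C
       * (\<Prod>i\<in>B. \<Prod>j\<in>C. (1 - t * (y i * y j)) / (1 - y i * y j))"
  using assms
proof (induction B rule: finite_induct)
  case (insert k B)
  then have "pair_prod t y (insert k (B \<union> C)) = (\<Prod>j\<in>B \<union> C. (1 - t * (y k * y j)) / (1 - y k * y j))
      * pair_prod t y (B \<union> C)" by (intro pair_prod_insert) auto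
  with insert show ?case by (simp add: pair_prod_insert prod.union_disjoint mult_ac)
qed simp

lemma pair_prod_cong: "(\<And>i. i \<in> A \<Longrightarrow> y i = y' i) \<Longrightarrow> pair_prod t y A = pair_prod t y' A"
  unfolding pair_prod_def by (intro prod.cong) auto

section \<open>Symmetrisation identities\<close>

lemma divide_diff_swap_mult:
  fixes a b c :: "'a::field"
  assumes "a \<noteq> b"
  shows "(a - c) / (a - b) * (b - a) = c - a"
proof -
  have "(a - c) / (a - b) * (b - a) = - ((a - c) / (a - b) * (a - b))"
    by (metis minus_diff_eq mult_minus_right)
  then show ?thesis using assms by simp
qed

text \<open>With k adjoined to A, replacing \<open>x k\<close> by an indeterminate X and clearing
  denominators leaves a polynomial of degree at most \<open>card A\<close>. It vanishes at the
  \<open>card A\<close> points \<open>x l\<close>, where the simple poles of two summands cancel,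
  and at 0, where the induction hypothesis applies. Since no \<open>x l\<close> is 0, this is one
  root too many.\<close>

lemma sum_prod_cross_eq_geometric:
  fixes x :: "'i \<Rightarrow> 'a::field"
  assumes "finite A" "inj_on x A" "\<And>i. i \<in> A \<Longrightarrow> x i \<noteq> 0"
  shows "(\<Sum>k\<in>A. \<Prod>j\<in>A - {k}. (x k - t * x j) / (x k - x j)) = (\<Sum>i<card A. t ^ i)"
  using assms
proof (induction A rule: finite_induct)
  case (insert k A)
  note fin = insert.hyps(1) and k = insert.hyps(2)
  define a where "a l = (\<Prod>j\<in>A - {l}. (x l - t * x j) / (x l - x j))" for l
  have IH: "(\<Sum>l\<in>A. a l) = (\<Sum>i<card A. t ^ i)"
    unfolding a_def using insert by (intro insert.IH) auto
  have ne: "x i \<noteq> x j" if "i \<in> insert k A" "j \<in> insert k A" "i \<noteq> j" for i j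
    using insert.prems(1) that by (auto simp: inj_on_def)
  \<comment> \<open>The difference of the two sides times the product of X - x j over A. The factor
    t X - x l is what (x l - t X) / (x l - X) becomes after multiplication by X - x l.\<close>
  define P where "P = (\<Sum>l\<in>A. smult (a l) ([:- x l, t:] * (\<Prod>j\<in>A - {l}. [:- x j, 1:])))
      + (\<Prod>j\<in>A. [:- t * x j, 1:]) - smult (\<Sum>i<Suc (card A). t ^ i) (\<Prod>j\<in>A. [:- x j, 1:])"
  have "P = 0"
  proof (rule poly_eq_0_if_many_roots[of _ "card A" "insert 0 (x ` A)"])
    have "degree ([:- x l, t:] * (\<Prod>j\<in>A - {l}. [:- x j, 1:])) \<le> card A" if "l \<in> A" for l
    proof -
      have "degree (\<Prod>j\<in>A - {l}. [:- x j, 1:]) \<le> 1 * card (A - {l})" by (rule degree_prod_le) simp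
      moreover have "1 + card (A - {l}) = card A" using that fin card_Suc_Diff1[of A l] by simp
      ultimately show ?thesis
        using degree_mult_le[of "[:- x l, t:]" "\<Prod>j\<in>A - {l}. [:- x j, 1:]"]
        by (auto split: if_splits)
    qed
    moreover have "degree (\<Prod>j\<in>A. [:c * x j, 1:]) \<le> card A" for c
      using degree_prod_le[of A "\<lambda>j. [:c * x j, 1:]" 1] by simp
    from this[of "- t"] this[of "- 1"] have
      "degree (\<Prod>j\<in>A. [:- t * x j, 1:]) \<le> card A" "degree (\<Prod>j\<in>A. [:- x j, 1:]) \<le> card A" by simp_all
    ultimately show "degree P \<le> card A" unfolding P_def using fin
      by (intro degree_diff_le degree_add_le degree_sum_le order.trans[OF degree_smult_le]) auto
    have "card (x ` A) = card A" "0 \<notin> x ` A"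
      using insert.prems by (auto simp: card_image inj_on_subset)
    then show "card A < card (insert 0 (x ` A))" using fin by simp
    fix z assume "z \<in> insert 0 (x ` A)"
    then consider "z = 0" | l where "l \<in> A" "z = x l" by auto
    then show "poly P z = 0"
    proof cases
      case 1
      have "(\<Sum>l\<in>A. a l * (- x l * (\<Prod>j\<in>A - {l}. - x j))) = (\<Sum>l\<in>A. a l) * (\<Prod>j\<in>A. - x j)"
        unfolding sum_distrib_right using fin by (intro sum.cong refl) (subst (2) prod.remove, auto)
      moreover have "(\<Prod>j\<in>A. - (t * x j)) = t ^ card A * (\<Prod>j\<in>A. - x j)"
        by (subst prod_constant[symmetric], subst prod.distrib[symmetric]) simp
      ultimately show ?thesis
        by (simp add: P_def 1 poly_sum poly_prod IH algebra_simps)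
    next
      case (2 l)
      have A: "A = insert l (A - {l})" using 2 by auto
      have zero: "(\<Prod>j\<in>A. z - x j) = 0" using 2 fin by auto
      have "(\<Sum>i\<in>A. a i * ((t * z - x i) * (\<Prod>j\<in>A - {i}. z - x j)))
          = (\<Sum>i\<in>A. if i = l then a l * ((t * z - x l) * (\<Prod>j\<in>A - {l}. z - x j)) else 0)"
        using 2 fin by (intro sum.cong) auto
      also have "\<dots> = (t - 1) * z * (a l * (\<Prod>j\<in>A - {l}. z - x j))"
        using 2 fin by (simp add: algebra_simps)
      also have "a l * (\<Prod>j\<in>A - {l}. z - x j) = (\<Prod>j\<in>A - {l}. z - t * x j)"
        unfolding a_def prod.distrib[symmetric] using 2 ne by (intro prod.cong) auto
      also have "(t - 1) * z * (\<Prod>j\<in>A - {l}. z - t * x j) = - (\<Prod>j\<in>A. z - t * x j)"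
        using 2 fin by (subst (2) A, subst prod.insert) (auto simp: algebra_simps)
      finally show ?thesis using zero
        by (simp add: P_def poly_sum poly_prod algebra_simps)
    qed
  qed (use fin in auto)
  then have "poly P (x k) = 0" by simp
  define Q where "Q = (\<Prod>j\<in>A. x k - x j)"
  have "Q \<noteq> 0" unfolding Q_def using ne k fin by (auto simp: prod_zero_iff)
  have "(\<Sum>l\<in>A. \<Prod>j\<in>insert k A - {l}. (x l - t * x j) / (x l - x j)) * Q
      = (\<Sum>l\<in>A. a l * ((t * x k - x l) * (\<Prod>j\<in>A - {l}. x k - x j)))"
    unfolding sum_distrib_right
  proof (rule sum.cong)
    fix l assume l: "l \<in> A"
    then have sets: "insert k A - {l} = insert k (A - {l})" using k by auto
    have Q: "Q = (x k - x l) * (\<Prod>j\<in>A - {l}. x k - x j)"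
      unfolding Q_def using l fin by (simp add: prod.remove)
    have "l \<noteq> k" using l k by auto
    then have swap: "(x l - t * x k) / (x l - x k) * (x k - x l) = t * x k - x l"
      using ne[of l k] l by (intro divide_diff_swap_mult) auto
    show "(\<Prod>j\<in>insert k A - {l}. (x l - t * x j) / (x l - x j)) * Q =
        a l * ((t * x k - x l) * (\<Prod>j\<in>A - {l}. x k - x j))"
      unfolding sets Q swap[symmetric] a_def using fin k by (simp add: mult_ac)
  qed simp
  moreover have "(\<Prod>j\<in>A. (x k - t * x j) / (x k - x j)) * Q = (\<Prod>j\<in>A. x k - t * x j)"
    unfolding Q_def prod.distrib[symmetric] using ne k by (intro prod.cong) auto
  moreover have "insert k A - {k} = A" using k by auto
  ultimately have "(\<Sum>l\<in>insert k A. \<Prod>j\<in>insert k A - {l}. (x l - t * x j) / (x l - x j)) * Q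
      = (\<Sum>i<Suc (card A). t ^ i) * Q"
    using \<open>poly P (x k) = 0\<close> fin k
    by (simp add: P_def poly_sum poly_prod Q_def algebra_simps)
  then show ?case using \<open>Q \<noteq> 0\<close> fin k by simp
qed simp

text \<open>Again one variable is made indeterminate and roots are counted at 0 and at the remaining
  \<open>x l\<close>. At 0 every summand vanishes by itself; at \<open>x l\<close> the summands of B
  and of \<open>insert l B\<close> cancel, which reflects the absence of a pole at equal
  variables.\<close>

lemma hl_star_monomial_power:
  fixes x :: "'i \<Rightarrow> 'a::field"
  assumes "finite A" "inj_on x A" "\<And>i. i \<in> A \<Longrightarrow> x i \<noteq> 0"
  shows "hl_star t x (\<lambda>B. \<Prod>i\<in>B. x i) (\<lambda>C. z ^ card C) A = (\<Prod>i\<in>A. x i + z)"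
  using assms
proof (induction A rule: finite_induct)
  case (insert k A)
  note fin = insert.hyps(1) and k = insert.hyps(2)
  define e where "e B = (\<Prod>i\<in>B. x i) * z ^ card (A - B) * hl_cross t x B (A - B)" for B
  have IH: "(\<Sum>B\<in>Pow A. e B) = (\<Prod>i\<in>A. x i + z)"
    using insert by (simp add: e_def hl_star_def)
  have ne: "x i \<noteq> x j" if "i \<in> insert k A" "j \<in> insert k A" "i \<noteq> j" for i j
    using insert.prems(1) that by (auto simp: inj_on_def)
  have finB: "finite B" "finite (A - B)" "card B + card (A - B) = card A" if "B \<in> Pow A" for B
    using that fin finite_subset[of B A] card_Diff_subset[of B A] card_mono[of A B] by auto
  \<comment> \<open>By \<open>IH\<close> the right-hand side is distributed over the same summands.
    Its part with X is subtracted from the term in which k joins the block B, its part with z from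
    the term in which k stays outside. The terms with X have degree \<open>card A + 1\<close> each;
    only their difference has degree at most \<open>card A\<close>.\<close>
  define p where "p B =
      [:0, 1:] * ((\<Prod>j\<in>A - B. [:- (t * x j), 1:]) - (\<Prod>j\<in>A - B. [:- x j, 1:])) * (\<Prod>i\<in>B. [:- x i, 1:])
      + smult z (((\<Prod>i\<in>B. [:- x i, t:]) - (\<Prod>i\<in>B. [:- x i, 1:])) * (\<Prod>j\<in>A - B. [:- x j, 1:]))" for B
  define P where "P = (\<Sum>B\<in>Pow A. smult (e B) (p B))"
  have poly_p: "poly (p B) X = X * ((\<Prod>j\<in>A - B. X - t * x j) * (\<Prod>i\<in>B. X - x i))
      + z * ((\<Prod>i\<in>B. t * X - x i) * (\<Prod>j\<in>A - B. X - x j)) - (X + z) * (\<Prod>i\<in>A. X - x i)"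
    if "B \<in> Pow A" for B X
  proof -
    have "(\<Prod>i\<in>A. X - x i) = (\<Prod>i\<in>A - B. X - x i) * (\<Prod>i\<in>B. X - x i)"
      using that fin by (intro prod.subset_diff) auto
    then show ?thesis by (simp add: p_def poly_prod algebra_simps)
  qed
  have "P = 0"
  proof (rule poly_eq_0_if_many_roots[of _ "card A" "insert 0 (x ` A)"])
    have "degree (p B) \<le> card A" if B: "B \<in> Pow A" for B
    proof -
      have d: "degree (\<Prod>i\<in>C. [:- x i, c:]) \<le> card C" for c C
        using degree_prod_le[of C "\<lambda>i. [:- x i, c:]" 1] by simp
      show ?thesis unfolding p_def finB(3)[OF B, symmetric]
        by (intro degree_add_le order.trans[OF degree_smult_le])
          (subst add.commute, (rule order.trans[OF degree_mult_le] add_mono degree_diff_le d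
             degree_prod_diff_less finB B)+)
    qed
    then show "degree P \<le> card A" unfolding P_def using fin
      by (intro degree_sum_le order.trans[OF degree_smult_le]) auto
    have "card (x ` A) = card A" "0 \<notin> x ` A"
      using insert.prems by (auto simp: card_image inj_on_subset)
    then show "card A < card (insert 0 (x ` A))" using fin by simp
    fix X assume "X \<in> insert 0 (x ` A)"
    then consider "X = 0" | l where "l \<in> A" "X = x l" by auto
    then show "poly P X = 0"
    proof cases
      case 1
      have "poly (p B) 0 = 0" if "B \<in> Pow A" for B
        by (simp add: p_def poly_prod)
      then show ?thesis by (simp add: P_def 1 poly_sum)
    next
      case (2 l)
      define A' where "A' = A - {l}"
      have A: "A = insert l A'" "l \<notin> A'" "finite A'" using 2 fin by (auto simp: A'_def)
      have zero: "(\<Prod>j\<in>A. X - x j) = 0" using 2 fin by auto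
      have "poly P X = (\<Sum>B\<in>Pow A. e B * poly (p B) X)" by (simp add: P_def poly_sum)
      also have "\<dots> = (\<Sum>B\<in>Pow A'. e B * poly (p B) X + e (insert l B) * poly (p (insert l B)) X)"
        unfolding A(1) using A(2,3) by (rule sum_Pow_insert[rotated])
      also have "\<dots> = 0"
      proof (rule sum.neutral, intro ballI)
        fix B assume B: "B \<in> Pow A'"
        define C where "C = A' - B"
        have f: "finite B" "finite C" "l \<notin> B" "l \<notin> C" using B A finite_subset by (auto simp: C_def)
        have S: "A - B = insert l C" "A - insert l B = C" using B A by (auto simp: C_def)
        have in_A: "B \<in> Pow A" "insert l B \<in> Pow A" using A B by auto
        have neX: "X \<noteq> x i" if "i \<in> B \<union> C" for i
          using ne[of l i] that A B 2 by (auto simp: C_def)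
        have 1: "(\<Prod>i\<in>B. (x i - t * X) / (x i - X)) * (\<Prod>i\<in>B. X - x i) = (\<Prod>i\<in>B. t * X - x i)"
          unfolding prod.distrib[symmetric] using neX by (intro prod.cong divide_diff_swap_mult) (auto dest: sym)
        have 2: "(\<Prod>j\<in>C. (X - t * x j) / (X - x j)) * (\<Prod>j\<in>C. X - x j) = (\<Prod>j\<in>C. X - t * x j)"
          unfolding prod.distrib[symmetric] using neX by (intro prod.cong) auto
        have 3: "e B * poly (p B) X = (\<Prod>i\<in>B. x i) * z ^ Suc (card C) * hl_cross t x B C * X * (X - t * X) *
            (\<Prod>j\<in>C. X - t * x j) * ((\<Prod>i\<in>B. (x i - t * X) / (x i - X)) * (\<Prod>i\<in>B. X - x i))"
          unfolding poly_p[OF in_A(1)] zero using f \<open>X = x l\<close>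
          by (simp add: e_def S hl_cross_insert_right mult_ac)
        have 4: "e (insert l B) * poly (p (insert l B)) X = X * (\<Prod>i\<in>B. x i) * z ^ Suc (card C) *
            hl_cross t x B C * (t * X - X) * (\<Prod>i\<in>B. t * X - x i) *
            ((\<Prod>j\<in>C. (X - t * x j) / (X - x j)) * (\<Prod>j\<in>C. X - x j))"
          unfolding poly_p[OF in_A(2)] zero using f \<open>X = x l\<close>
          by (simp add: e_def S hl_cross_insert_left mult_ac)
        show "e B * poly (p B) X + e (insert l B) * poly (p (insert l B)) X = 0"
          unfolding 3 4 1 2 by (simp add: algebra_simps)
      qed
      finally show ?thesis .
    qed
  qed (use fin in auto)
  define X where "X = x k"
  define Q where "Q = (\<Prod>j\<in>A. X - x j)"
  have neX: "X \<noteq> x i" if "i \<in> A" for i using ne[of k i] that k by (auto simp: X_def)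
  then have "Q \<noteq> 0" unfolding Q_def using fin by (auto simp: prod_zero_iff)
  have "hl_star t x (\<lambda>B. \<Prod>i\<in>B. x i) (\<lambda>C. z ^ card C) (insert k A) * Q - (X + z) * (\<Prod>i\<in>A. x i + z) * Q
      = poly P X"
    unfolding hl_star_def sum_Pow_insert[OF fin k] IH[symmetric] sum_distrib_right sum_distrib_left
      P_def poly_sum sum_subtractf[symmetric]
  proof (rule sum.cong)
    fix B assume B: "B \<in> Pow A"
    define C where "C = A - B"
    have f: "finite B" "finite C" "k \<notin> B" "k \<notin> C" using B k finB by (auto simp: C_def)
    have S: "insert k A - B = insert k C" "insert k A - insert k B = C" "A - B = C"
      using B k by (auto simp: C_def)
    have Q: "Q = (\<Prod>i\<in>C. X - x i) * (\<Prod>i\<in>B. X - x i)"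
      unfolding Q_def C_def using B fin by (intro prod.subset_diff) auto
    have 1: "(\<Prod>i\<in>B. (x i - t * X) / (x i - X)) * (\<Prod>i\<in>B. X - x i) = (\<Prod>i\<in>B. t * X - x i)"
      unfolding prod.distrib[symmetric] using neX B by (intro prod.cong divide_diff_swap_mult) (auto dest: sym)
    have 2: "(\<Prod>j\<in>C. (X - t * x j) / (X - x j)) * (\<Prod>j\<in>C. X - x j) = (\<Prod>j\<in>C. X - t * x j)"
      unfolding prod.distrib[symmetric] using neX by (intro prod.cong) (auto simp: C_def)
    show "((\<Prod>i\<in>B. x i) * z ^ card (insert k A - B) * hl_cross t x B (insert k A - B)
        + (\<Prod>i\<in>insert k B. x i) * z ^ card (insert k A - insert k B)
          * hl_cross t x (insert k B) (insert k A - insert k B)) * Q - (X + z) * e B * Q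
      = poly (smult (e B) (p B)) X"
      unfolding poly_smult poly_p[OF B] Q_def[symmetric] S e_def
      using f by (simp add: hl_cross_insert_left hl_cross_insert_right X_def[symmetric]
        1[symmetric] 2[symmetric]) (simp add: Q algebra_simps)
  qed simp
  with \<open>P = 0\<close> \<open>Q \<noteq> 0\<close> fin k show ?case by (simp add: X_def)
qed (simp add: hl_star_def)

section \<open>The sum over all inversions of variables\<close>

definition B_kernel :: "'a::field \<Rightarrow> 'a \<Rightarrow> (nat \<Rightarrow> 'a) \<Rightarrow> nat set \<Rightarrow> 'a" where
  "B_kernel t t2 y A = (\<Prod>i\<in>A. (1 - t2 * y i) / (1 - y i)) * pair_prod t y A"

definition flip :: "('i \<Rightarrow> 'a::field) \<Rightarrow> 'i set \<Rightarrow> 'i \<Rightarrow> 'a" where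
  "flip x S i = (if i \<in> S then inverse (x i) else x i)"

text \<open>The last condition concerns distinct indices only, so a variable may equal - 1: no
  denominator contains 1 - (x i)^2.\<close>

definition B_generic :: "('i \<Rightarrow> 'a::field) \<Rightarrow> 'i set \<Rightarrow> bool" where
  "B_generic x A \<longleftrightarrow> finite A \<and> inj_on x A \<and> (\<forall>i\<in>A. x i \<noteq> 0 \<and> x i \<noteq> 1)
     \<and> (\<forall>i\<in>A. \<forall>j\<in>A. i \<noteq> j \<longrightarrow> x i * x j \<noteq> 1)"

lemma B_generic_subset: "B_generic x A \<Longrightarrow> B \<subseteq> A \<Longrightarrow> B_generic x B"
  unfolding B_generic_def by (meson finite_subset inj_on_subset subsetD)

lemma B_kernel_cong: "(\<And>i. i \<in> A \<Longrightarrow> y i = y' i) \<Longrightarrow> B_kernel t t2 y A = B_kernel t t2 y' A"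
  unfolding B_kernel_def using pair_prod_cong[of A y y' t] by simp

lemma B_kernel_insert:
  assumes "finite A" "k \<notin> A"
  shows "B_kernel t t2 y (insert k A) = (1 - t2 * y k) / (1 - y k)
     * (\<Prod>j\<in>A. (1 - t * (y k * y j)) / (1 - y k * y j)) * B_kernel t t2 y A"
  using assms by (simp add: B_kernel_def pair_prod_insert)

lemma inverse_factor:
  fixes X :: "'a::field"
  assumes "X \<noteq> 0"
  shows "(1 - a * (inverse X * y)) / (1 - inverse X * y) = (X - a * y) / (X - y)"
proof -
  have "1 - a * (inverse X * y) = (X - a * y) / X" "1 - inverse X * y = (X - y) / X"
    using assms by (simp_all add: field_simps)
  then show ?thesis using assms by simp
qed

text \<open>When a variable X is added to variables y, its two versions X and 1/X contribute factors
  with the common denominator (1 - X) times the product of (1 - X y j) (X - y j). This is the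
  numerator of their sum.\<close>

definition B_bracket :: "'a::field \<Rightarrow> 'a \<Rightarrow> (nat \<Rightarrow> 'a) \<Rightarrow> nat set \<Rightarrow> 'a \<Rightarrow> 'a" where
  "B_bracket t t2 y A X = (1 - t2 * X) * (\<Prod>j\<in>A. (1 - t * (X * y j)) * (X - y j))
     - (X - t2) * (\<Prod>j\<in>A. (X - t * y j) * (1 - X * y j))"

lemma B_bracket_cong: "(\<And>i. i \<in> A \<Longrightarrow> y i = y' i) \<Longrightarrow> B_bracket t t2 y A X = B_bracket t t2 y' A X"
  unfolding B_bracket_def by simp

text \<open>Cancellation of poles: X meets the old variable l, once uninverted and once inverted. At
  y l = X the first product of the bracket vanishes, at y l = 1/X the second one does, and the two
  surviving products complete the respective kernels to the same expression M. The weight X^2 is the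
  ratio of the denominators' normalisations, see \<open>s\<close> below.\<close>

lemma B_kernel_pair_cancel:
  fixes y :: "nat \<Rightarrow> 'a::field"
  assumes "finite A" "l \<notin> A" and X: "X \<noteq> 0" "X \<noteq> 1"
    and y: "\<And>j. j \<in> A \<Longrightarrow> X * y j \<noteq> 1" "\<And>j. j \<in> A \<Longrightarrow> X \<noteq> y j"
  shows "B_kernel t t2 (y(l := X)) (insert l A) * B_bracket t t2 (y(l := X)) (insert l A) X
     + X\<^sup>2 * (B_kernel t t2 (y(l := inverse X)) (insert l A)
         * B_bracket t t2 (y(l := inverse X)) (insert l A) X) = 0"
proof -
  define G where "G = B_kernel t t2 y A"
  have G: "B_kernel t t2 (y(l := v)) A = G" for v
    unfolding G_def using assms(2) by (intro B_kernel_cong) auto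
  define M where "M = (\<Prod>j\<in>A. (1 - t * (X * y j)) * (X - t * y j))"
  have upd: "(\<Prod>j\<in>A. h ((y(l := v)) j)) = (\<Prod>j\<in>A. h (y j))" for h :: "'a \<Rightarrow> 'a" and v
    using assms(2) by (intro prod.cong) auto
  have 1: "(\<Prod>j\<in>A. (1 - t * (X * y j)) / (1 - X * y j)) * (\<Prod>j\<in>A. (X - t * y j) * (1 - X * y j)) = M"
    unfolding M_def prod.distrib[symmetric] using y by (intro prod.cong) auto
  have 2: "(\<Prod>j\<in>A. (X - t * y j) / (X - y j)) * (\<Prod>j\<in>A. (1 - t * (X * y j)) * (X - y j)) = M"
    unfolding M_def prod.distrib[symmetric] using y by (intro prod.cong) auto
  have b1: "B_bracket t t2 (y(l := X)) (insert l A) X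
      = - ((X - t2) * (X - t * X) * (1 - X * X)) * (\<Prod>j\<in>A. (X - t * y j) * (1 - X * y j))"
    unfolding B_bracket_def prod.insert[OF assms(1,2)]
      upd[of "\<lambda>v. (X - t * v) * (1 - X * v)"] by (simp add: mult_ac)
  have b2: "B_bracket t t2 (y(l := inverse X)) (insert l A) X
      = (1 - t2 * X) * (1 - t) * (X - inverse X) * (\<Prod>j\<in>A. (1 - t * (X * y j)) * (X - y j))"
    unfolding B_bracket_def prod.insert[OF assms(1,2)]
      upd[of "\<lambda>v. (1 - t * (X * v)) * (X - v)"] using X by (simp add: mult_ac)
  have k1: "B_kernel t t2 (y(l := X)) (insert l A)
      = (1 - t2 * X) / (1 - X) * (\<Prod>j\<in>A. (1 - t * (X * y j)) / (1 - X * y j)) * G"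
    unfolding B_kernel_insert[OF assms(1,2)] G fun_upd_same
      upd[of "\<lambda>v. (1 - t * (X * v)) / (1 - X * v)"] ..
  have k2: "B_kernel t t2 (y(l := inverse X)) (insert l A)
      = (X - t2) / (X - 1) * (\<Prod>j\<in>A. (X - t * y j) / (X - y j)) * G"
    unfolding B_kernel_insert[OF assms(1,2)] G fun_upd_same
      upd[of "\<lambda>v. (1 - t * (inverse X * v)) / (1 - inverse X * v)"]
    using inverse_factor[OF X(1), of _ 1] by (simp only: inverse_factor[OF X(1)] mult_1_right)
  have p1: "B_kernel t t2 (y(l := X)) (insert l A) * B_bracket t t2 (y(l := X)) (insert l A) X
      = - ((1 - t2 * X) * (X - t2) * (X - t * X) * ((1 - X * X) / (1 - X)) * G * M)"
    unfolding k1 b1 1[symmetric] by (simp add: mult_ac)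
  have q1: "(1 - X * X) / (1 - X) = 1 + X" using X by (simp add: field_simps)
  have p2: "X\<^sup>2 * (B_kernel t t2 (y(l := inverse X)) (insert l A)
         * B_bracket t t2 (y(l := inverse X)) (insert l A) X)
      = (1 - t2 * X) * (X - t2) * (1 - t) * (X\<^sup>2 * (X - inverse X) / (X - 1)) * G * M"
    unfolding k2 b2 2[symmetric] by (simp add: mult_ac)
  have q2: "X\<^sup>2 * (X - inverse X) / (X - 1) = X * (1 + X)"
    using X by (simp add: field_simps power2_eq_square)
  show ?thesis unfolding p1 p2 q1 q2 by (simp add: algebra_simps)
qed

text \<open>As a function of X = x k, the difference of the sides becomes, after clearing
  denominators, a polynomial of degree at most 2 \<open>card A\<close> + 1. It has the roots 0, 1,
  \<open>x l\<close> and the inverse of \<open>x l\<close> for l in A, and these are 2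
  \<open>card A\<close> + 2 distinct points precisely because no \<open>x l\<close> with l in A
  equals 1 or - 1 and no two of them are equal or mutually inverse.\<close>

lemma sum_B_kernel_flip_step:
  fixes x :: "nat \<Rightarrow> 'a::field"
  assumes gen: "B_generic x (insert k A)" and k: "k \<notin> A" and ne_m1: "\<And>j. j \<in> A \<Longrightarrow> x j \<noteq> - 1"
  shows "(\<Sum>S\<in>Pow (insert k A). B_kernel t t2 (flip x S) (insert k A))
       = (1 + t2 * t ^ card A) * (\<Sum>S\<in>Pow A. B_kernel t t2 (flip x S) A)"
proof -
  have fin: "finite A" and inj: "inj_on x (insert k A)"
    and nz: "\<And>i. i \<in> insert k A \<Longrightarrow> x i \<noteq> 0" and n1: "\<And>i. i \<in> insert k A \<Longrightarrow> x i \<noteq> 1"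
    and prod1: "\<And>i j. i \<in> insert k A \<Longrightarrow> j \<in> insert k A \<Longrightarrow> i \<noteq> j \<Longrightarrow> x i * x j \<noteq> 1"
    using gen by (auto simp: B_generic_def)
  have ne: "x i \<noteq> x j" if "i \<in> insert k A" "j \<in> insert k A" "i \<noteq> j" for i j
    using inj that by (auto simp: inj_on_def)
  have sq: "x i * x i \<noteq> 1" if "i \<in> A" for i
    using n1[of i] ne_m1[of i] that by (auto simp: square_eq_1_iff)
  have prodA: "x i * x j \<noteq> 1" if "i \<in> A" "j \<in> A" for i j
    using sq prod1 that by (cases "i = j") auto
  define \<kappa> where "\<kappa> = 1 + t2 * t ^ card A"
  \<comment> \<open>Since x^2 (1 - X/x) (X - 1/x) = (1 - X x) (X - x), the factor \<open>s S\<close>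
    brings the denominators of all sign patterns S to the common value \<open>den X\<close>.\<close>
  define s where "s S = (\<Prod>j\<in>S. (x j)\<^sup>2)" for S
  define c where "c S = B_kernel t t2 (flip x S) A" for S
  define den where "den X = (1 - X) * (\<Prod>j\<in>A. (1 - X * x j) * (X - x j))" for X
  have s_flip: "s S * (\<Prod>j\<in>A. (1 - X * flip x S j) * (X - flip x S j)) = (\<Prod>j\<in>A. (1 - X * x j) * (X - x j))"
    if "S \<subseteq> A" for S X
  proof -
    have "s S = (\<Prod>j\<in>A. if j \<in> S then (x j)\<^sup>2 else 1)"
      unfolding s_def using that fin by (simp add: prod.If_cases Int_absorb1)
    then have "s S * (\<Prod>j\<in>A. (1 - X * flip x S j) * (X - flip x S j))
       = (\<Prod>j\<in>A. (if j \<in> S then (x j)\<^sup>2 else 1) * ((1 - X * flip x S j) * (X - flip x S j)))"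
      by (simp add: prod.distrib)
    also have "\<dots> = (\<Prod>j\<in>A. (1 - X * x j) * (X - x j))"
      using nz by (intro prod.cong) (auto simp: flip_def field_simps power2_eq_square)
    finally show ?thesis .
  qed
  define b where "b S = [:1, - t2:] * (\<Prod>j\<in>A. [:1, - (t * flip x S j):] * [:- flip x S j, 1:])
      - [:- t2, 1:] * (\<Prod>j\<in>A. [:- (t * flip x S j), 1:] * [:1, - flip x S j:])
      - smult \<kappa> ([:1, - 1:] * (\<Prod>j\<in>A. [:1, - flip x S j:] * [:- flip x S j, 1:]))" for S
  have poly_b: "poly (b S) X = B_bracket t t2 (flip x S) A X
      - \<kappa> * ((1 - X) * (\<Prod>j\<in>A. (1 - X * flip x S j) * (X - flip x S j)))" for S X
    unfolding b_def poly_diff poly_mult poly_prod poly_smult by (simp add: B_bracket_def mult_ac)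
  define P where "P = (\<Sum>S\<in>Pow A. smult (c S * s S) (b S))"
  have "P = 0"
  proof (rule poly_eq_0_if_many_roots[of _ "1 + 2 * card A"
        "insert 0 (insert 1 (x ` A \<union> (\<lambda>i. inverse (x i)) ` A))"])
    have "degree (b S) \<le> 1 + 2 * card A" for S
    proof -
      have d: "degree (\<Prod>j\<in>A. [:u j, u' j:] * [:v j, v' j:]) \<le> 2 * card A" for u u' v v' :: "nat \<Rightarrow> 'a"
      proof (rule degree_prod_le)
        fix j
        show "degree ([:u j, u' j:] * [:v j, v' j:]) \<le> 2"
          by (rule order.trans[OF degree_mult_le]) simp
      qed
      have "degree ([:a, a':] * (\<Prod>j\<in>A. [:u j, u' j:] * [:v j, v' j:])) \<le> 1 + 2 * card A"
        for a a' :: 'a and u u' v v' by (rule order.trans[OF degree_mult_le], rule add_mono[OF _ d]) simp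
      then show ?thesis unfolding b_def
        by (intro degree_diff_le order.trans[OF degree_smult_le])
    qed
    then show "degree P \<le> 1 + 2 * card A" unfolding P_def using fin
      by (intro degree_sum_le order.trans[OF degree_smult_le]) auto
    have "card (x ` A) = card A" "card ((\<lambda>i. inverse (x i)) ` A) = card A"
      using inj by (auto intro!: card_image simp: inj_on_def)
    moreover have "x ` A \<inter> (\<lambda>i. inverse (x i)) ` A = {}"
      using prodA nz by (force simp: field_simps)
    moreover have "0 \<notin> x ` A \<union> (\<lambda>i. inverse (x i)) ` A" "1 \<notin> x ` A \<union> (\<lambda>i. inverse (x i)) ` A"
      using nz n1 by (auto simp: eq_commute[of 1])
    ultimately show "1 + 2 * card A < card (insert 0 (insert 1 (x ` A \<union> (\<lambda>i. inverse (x i)) ` A)))"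
      using fin by (simp add: card_Un_disjoint)
    fix X assume X: "X \<in> insert 0 (insert 1 (x ` A \<union> (\<lambda>i. inverse (x i)) ` A))"
    have P_X: "poly P X = (\<Sum>S\<in>Pow A. c S * s S * B_bracket t t2 (flip x S) A X) - \<kappa> * den X * (\<Sum>S\<in>Pow A. c S)"
      unfolding P_def poly_sum sum_distrib_left sum_subtractf[symmetric] poly_smult poly_b den_def
    proof (rule sum.cong)
      fix S assume "S \<in> Pow A"
      then have "(\<Prod>j\<in>A. (1 - X * x j) * (X - x j))
          = s S * (\<Prod>j\<in>A. (1 - X * flip x S j) * (X - flip x S j))" by (simp add: s_flip)
      then show "c S * s S * (B_bracket t t2 (flip x S) A X
            - \<kappa> * ((1 - X) * (\<Prod>j\<in>A. (1 - X * flip x S j) * (X - flip x S j))))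
          = c S * s S * B_bracket t t2 (flip x S) A X
            - \<kappa> * ((1 - X) * (\<Prod>j\<in>A. (1 - X * x j) * (X - x j))) * c S"
        by (simp only: right_diff_distrib mult_ac)
    qed simp
    have root: "poly P X = 0" if l: "l \<in> A" and X: "X = x l \<or> X = inverse (x l)" for l
    proof -
      have "(1 - X * x l) * (X - x l) = 0" using l X nz[of l] by auto
      then have "(\<Prod>j\<in>A. (1 - X * x j) * (X - x j)) = 0" using l fin by (intro prod_zero) blast+
      then have den: "den X = 0" by (simp add: den_def)
      define A' where "A' = A - {l}"
      have A: "A = insert l A'" "l \<notin> A'" "finite A'" using l fin by (auto simp: A'_def)
      have X01: "X \<noteq> 0" "X \<noteq> 1" using X nz[of l] n1[of l] l by auto
      have "(\<Sum>S\<in>Pow A. c S * s S * B_bracket t t2 (flip x S) A X) = (\<Sum>S\<in>Pow A'.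
          c S * s S * B_bracket t t2 (flip x S) A X
          + c (insert l S) * s (insert l S) * B_bracket t t2 (flip x (insert l S)) A X)"
        unfolding A(1) using A(2,3) by (rule sum_Pow_insert[rotated])
      also have "\<dots> = 0"
      proof (rule sum.neutral, intro ballI)
        fix S assume S: "S \<in> Pow A'"
        then have lS: "l \<notin> S" "finite S" using A finite_subset by auto
        define y where "y = flip x S"
        have neq: "X * y j \<noteq> 1" "X \<noteq> y j" if "j \<in> A'" for j
        proof -
          have "l \<noteq> j" "j \<in> A" using that A by auto
          then have "x l \<noteq> x j" "x l * x j \<noteq> 1" "x j \<noteq> 0" "x l \<noteq> 0"
            using ne[of l j] prod1[of l j] l nz[of j] nz[of l] by auto
          then have "x l * inverse (x j) \<noteq> 1" "inverse (x l) * x j \<noteq> 1" "inverse (x l) * inverse (x j) \<noteq> 1"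
            "x l \<noteq> inverse (x j)" "inverse (x l) \<noteq> x j" "inverse (x l) \<noteq> inverse (x j)"
            by (auto simp: field_simps)
          with \<open>x l \<noteq> x j\<close> \<open>x l * x j \<noteq> 1\<close> show "X * y j \<noteq> 1" "X \<noteq> y j"
            using X by (auto simp: y_def flip_def)
        qed
        have t1: "c S * B_bracket t t2 (flip x S) A X
            = B_kernel t t2 (y(l := x l)) (insert l A') * B_bracket t t2 (y(l := x l)) (insert l A') X"
          unfolding c_def A(1) using lS
          by (intro arg_cong2[where f = "(*)"] B_kernel_cong B_bracket_cong) (auto simp: y_def flip_def)
        have t2': "c (insert l S) * B_bracket t t2 (flip x (insert l S)) A X
            = B_kernel t t2 (y(l := inverse (x l))) (insert l A')
              * B_bracket t t2 (y(l := inverse (x l))) (insert l A') X"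
          unfolding c_def A(1) using lS
          by (intro arg_cong2[where f = "(*)"] B_kernel_cong B_bracket_cong) (auto simp: y_def flip_def)
        have "c S * B_bracket t t2 (flip x S) A X
           + (x l)\<^sup>2 * (c (insert l S) * B_bracket t t2 (flip x (insert l S)) A X) = 0"
          using X
        proof
          assume "X = x l"
          then show ?thesis unfolding t1 t2'
            using B_kernel_pair_cancel[of A' l X y t t2] A X01 neq by simp
        next
          \<comment> \<open>The same cancellation with the roles of S and \<open>insert l S\<close>
            exchanged, after pulling out the square of \<open>x l\<close>, which is the inverse of
            X^2.\<close>
          assume X': "X = inverse (x l)"
          then have xl: "x l = inverse X" by simp
          have "(x l)\<^sup>2 * X\<^sup>2 = 1" using X01 xl by (simp flip: power_mult_distrib)
          then have "c S * B_bracket t t2 (flip x S) A X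
             + (x l)\<^sup>2 * (c (insert l S) * B_bracket t t2 (flip x (insert l S)) A X)
             = (x l)\<^sup>2 * (c (insert l S) * B_bracket t t2 (flip x (insert l S)) A X
                + X\<^sup>2 * (c S * B_bracket t t2 (flip x S) A X))"
            by (simp only: distrib_left mult.assoc[symmetric]) (simp add: add.commute)
          also have "\<dots> = 0" unfolding t1 t2' unfolding xl inverse_inverse_eq
            using B_kernel_pair_cancel[of A' l X y t t2] A X01 neq by simp
          finally show ?thesis .
        qed
        moreover have "s (insert l S) = (x l)\<^sup>2 * s S" using lS by (simp add: s_def)
        ultimately have "s S * (c S * B_bracket t t2 (flip x S) A X
           + (x l)\<^sup>2 * (c (insert l S) * B_bracket t t2 (flip x (insert l S)) A X)) = 0" by simp
        then show "c S * s S * B_bracket t t2 (flip x S) A X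
          + c (insert l S) * s (insert l S) * B_bracket t t2 (flip x (insert l S)) A X = 0"
          unfolding \<open>s (insert l S) = (x l)\<^sup>2 * s S\<close> by (simp add: algebra_simps)
      qed
      finally show ?thesis by (simp add: P_X den)
    qed
    \<comment> \<open>The value at 0 is where \<kappa> comes from: there the bracket reduces to the
      product of the - y j plus t2 times the product of the - t y j. At 1 the two products of the
      bracket agree and the denominator vanishes. Both hold for each S separately.\<close>
    have const: "poly (b S) 0 = 0" "poly (b S) 1 = 0" for S
    proof -
      have "(\<Prod>j\<in>A. t * flip x S j) = t ^ card A * (\<Prod>j\<in>A. flip x S j)" by (simp add: prod.distrib)
      then have "(\<Prod>j\<in>A. - (t * flip x S j)) = t ^ card A * (\<Prod>j\<in>A. - flip x S j)"
        using prod_uminus[of "\<lambda>j. t * flip x S j" A] prod_uminus[of "flip x S" A] by simp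
      then show "poly (b S) 0 = 0"
        unfolding poly_b by (simp add: B_bracket_def \<kappa>_def algebra_simps)
      show "poly (b S) 1 = 0"
        unfolding poly_b by (simp add: B_bracket_def mult_ac)
    qed
    then show "poly P X = 0" using X root by (auto simp: P_def poly_sum)
  qed (use fin in auto)
  define X where "X = x k"
  have X: "X \<noteq> 0" "X \<noteq> 1" "\<And>j. j \<in> A \<Longrightarrow> X * x j \<noteq> 1" "\<And>j. j \<in> A \<Longrightarrow> X \<noteq> x j"
    unfolding X_def using nz n1 prod1 ne k by blast+
  then have "den X \<noteq> 0" unfolding den_def using fin by (auto simp: prod_zero_iff eq_commute[of 1])
  have "((\<Sum>S\<in>Pow (insert k A). B_kernel t t2 (flip x S) (insert k A)) - \<kappa> * (\<Sum>S\<in>Pow A. c S)) * den X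
      = poly P X"
    unfolding sum_Pow_insert[OF fin k] sum_distrib_left sum_distrib_right sum_subtractf[symmetric]
      P_def poly_sum
  proof (rule sum.cong)
    fix S assume S: "S \<in> Pow A"
    then have kS: "k \<notin> S" using k by auto
    have y: "X * flip x S j \<noteq> 1" "X \<noteq> flip x S j" if "j \<in> A" for j
      using X(3,4)[OF that] nz[of j] X(1) that by (auto simp: flip_def field_simps)
    have upd: "(\<Prod>j\<in>A. h (flip x (insert k S) j)) = (\<Prod>j\<in>A. h (flip x S j))" for h :: "'a \<Rightarrow> 'a"
      using k by (intro prod.cong) (auto simp: flip_def)
    have c': "B_kernel t t2 (flip x (insert k S)) A = c S"
      unfolding c_def using k by (intro B_kernel_cong) (auto simp: flip_def)
    have den: "den X = s S * (1 - X) * (\<Prod>j\<in>A. (1 - X * flip x S j) * (X - flip x S j))"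
      using S s_flip[of S X] by (simp add: den_def mult_ac del: mult_cancel_left mult_cancel_right)
    have flipk: "flip x S k = X" "flip x (insert k S) k = inverse X"
      using kS by (simp_all add: flip_def X_def)
    have 1: "B_kernel t t2 (flip x S) (insert k A) = (1 - t2 * X) / (1 - X)
        * (\<Prod>j\<in>A. (1 - t * (X * flip x S j)) / (1 - X * flip x S j)) * c S"
      unfolding B_kernel_insert[OF fin k] flipk c_def ..
    have 2: "B_kernel t t2 (flip x (insert k S)) (insert k A) = (X - t2) / (X - 1)
        * (\<Prod>j\<in>A. (X - t * flip x S j) / (X - flip x S j)) * c S"
      unfolding B_kernel_insert[OF fin k] flipk c' upd[of "\<lambda>v. (1 - t * (inverse X * v)) / (1 - inverse X * v)"]
      using inverse_factor[OF X(1), of _ 1] by (simp only: inverse_factor[OF X(1)] mult_1_right)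
    have 3: "(\<Prod>j\<in>A. (1 - t * (X * flip x S j)) / (1 - X * flip x S j))
        * (\<Prod>j\<in>A. (1 - X * flip x S j) * (X - flip x S j)) = (\<Prod>j\<in>A. (1 - t * (X * flip x S j)) * (X - flip x S j))"
      unfolding prod.distrib[symmetric] using y by (intro prod.cong) auto
    have 4: "(\<Prod>j\<in>A. (X - t * flip x S j) / (X - flip x S j))
        * (\<Prod>j\<in>A. (1 - X * flip x S j) * (X - flip x S j)) = (\<Prod>j\<in>A. (X - t * flip x S j) * (1 - X * flip x S j))"
      unfolding prod.distrib[symmetric] using y by (intro prod.cong) auto
    have 5: "(1 - t2 * X) / (1 - X) * (1 - X) = 1 - t2 * X" "(X - t2) / (X - 1) * (1 - X) = t2 - X"
      using X divide_diff_swap_mult[of X 1 t2] by auto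
    have 6: "B_kernel t t2 (flip x S) (insert k A) * den X
        = c S * s S * ((1 - t2 * X) / (1 - X) * (1 - X))
          * ((\<Prod>j\<in>A. (1 - t * (X * flip x S j)) / (1 - X * flip x S j))
             * (\<Prod>j\<in>A. (1 - X * flip x S j) * (X - flip x S j)))"
      unfolding 1 den by (simp only: mult_ac)
    have 7: "B_kernel t t2 (flip x (insert k S)) (insert k A) * den X
        = c S * s S * ((X - t2) / (X - 1) * (1 - X))
          * ((\<Prod>j\<in>A. (X - t * flip x S j) / (X - flip x S j))
             * (\<Prod>j\<in>A. (1 - X * flip x S j) * (X - flip x S j)))"
      unfolding 2 den by (simp only: mult_ac)
    have "(B_kernel t t2 (flip x S) (insert k A) + B_kernel t t2 (flip x (insert k S)) (insert k A)
        - \<kappa> * c S) * den X = B_kernel t t2 (flip x S) (insert k A) * den X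
        + B_kernel t t2 (flip x (insert k S)) (insert k A) * den X - \<kappa> * c S * den X"
      by (simp only: left_diff_distrib distrib_right)
    also have "\<dots> = poly (smult (c S * s S) (b S)) X"
      unfolding 6 7 3 4 5 unfolding den poly_smult poly_b B_bracket_def by (simp add: algebra_simps)
    finally show "(B_kernel t t2 (flip x S) (insert k A) + B_kernel t t2 (flip x (insert k S)) (insert k A)
        - \<kappa> * c S) * den X = poly (smult (c S * s S) (b S)) X" .
  qed simp
  with \<open>P = 0\<close> \<open>den X \<noteq> 0\<close> show ?thesis by (simp add: \<kappa>_def c_def)
qed

lemma sum_B_kernel_flip:
  fixes x :: "nat \<Rightarrow> 'a::field"
  assumes "B_generic x A"
  shows "(\<Sum>S\<in>Pow A. B_kernel t t2 (flip x S) A) = qpoch (- t2) t (card A)"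
proof -
  have "finite A" using assms by (simp add: B_generic_def)
  then show ?thesis using assms
  proof (induction A rule: finite_psubset_induct)
    case (psubset A)
    show ?case
    proof (cases "A = {}")
      case True
      then show ?thesis by (simp add: B_kernel_def qpoch_def)
    next
      case False
      \<comment> \<open>At most one variable equals \<open>- 1\<close>; it is split off first because the roots \<open>x j\<close> and
        \<open>inverse (x j)\<close> of the other variables must be distinct.\<close>
      obtain k where k: "k \<in> A" "\<And>j. j \<in> A - {k} \<Longrightarrow> x j \<noteq> - 1"
      proof (cases "\<exists>k\<in>A. x k = - 1")
        case True
        then obtain k where k: "k \<in> A" "x k = - 1" by auto
        then have "x j \<noteq> - 1" if "j \<in> A - {k}" for j
          using that psubset.prems inj_onD[of x A j k] by (auto simp: B_generic_def)
        then show ?thesis by (rule that[OF k(1)])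
      qed (use False that in auto)
      have ins: "insert k (A - {k}) = A" using k by auto
      have "(\<Sum>S\<in>Pow A. B_kernel t t2 (flip x S) A)
          = (1 + t2 * t ^ card (A - {k})) * (\<Sum>S\<in>Pow (A - {k}). B_kernel t t2 (flip x S) (A - {k}))"
        by (rule sum_B_kernel_flip_step[of x k "A - {k}" t t2, unfolded ins]) (use k psubset.prems in auto)
      also have "(\<Sum>S\<in>Pow (A - {k}). B_kernel t t2 (flip x S) (A - {k})) = qpoch (- t2) t (card (A - {k}))"
        using k psubset.prems B_generic_subset[of x A "A - {k}"] by (intro psubset.IH) auto
      also have "(1 + t2 * t ^ card (A - {k})) * \<dots> = qpoch (- t2) t (Suc (card (A - {k})))"
        by (simp add: qpoch_def)
      finally show ?thesis using k psubset.hyps by (simp only: card_Suc_Diff1)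
    qed
  qed
qed

section \<open>The step from one level to the next\<close>

text \<open>This turns a sum over inversions into a product in the algebra: for i inverted and j
  not, (1 - t x_j / x_i) / (1 - x_j / x_i) is the cross factor (x_i - t x_j) / (x_i - x_j), while
  pairs on the same side stay within one kernel.\<close>

lemma B_kernel_flip:
  fixes x :: "nat \<Rightarrow> 'a::field"
  assumes "finite A" "S \<subseteq> A" "\<And>i. i \<in> A \<Longrightarrow> x i \<noteq> 0"
  shows "B_kernel t t2 (flip x S) A
       = B_kernel t t2 (\<lambda>i. inverse (x i)) S * B_kernel t t2 x (A - S) * hl_cross t x S (A - S)"
proof -
  have fin: "finite S" "finite (A - S)" using assms finite_subset by auto
  have A: "A = S \<union> (A - S)" "S \<inter> (A - S) = {}" using assms by auto
  let ?f = "\<lambda>y. (1 - t2 * y) / (1 - y)"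
  have "(\<Prod>i\<in>A. ?f (flip x S i)) = (\<Prod>i\<in>S. ?f (flip x S i)) * (\<Prod>i\<in>A - S. ?f (flip x S i))"
    by (subst A(1), subst prod.union_disjoint) (use fin in auto)
  also have "(\<Prod>i\<in>S. ?f (flip x S i)) = (\<Prod>i\<in>S. ?f (inverse (x i)))"
    by (intro prod.cong) (auto simp: flip_def)
  also have "(\<Prod>i\<in>A - S. ?f (flip x S i)) = (\<Prod>i\<in>A - S. ?f (x i))"
    by (intro prod.cong) (auto simp: flip_def)
  finally have 1: "(\<Prod>i\<in>A. ?f (flip x S i)) = (\<Prod>i\<in>S. ?f (inverse (x i))) * (\<Prod>i\<in>A - S. ?f (x i))" .
  have "pair_prod t (flip x S) A = pair_prod t (flip x S) S * pair_prod t (flip x S) (A - S)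
      * (\<Prod>i\<in>S. \<Prod>j\<in>A - S. (1 - t * (flip x S i * flip x S j)) / (1 - flip x S i * flip x S j))"
    using pair_prod_Un[OF fin A(2), of t "flip x S"] A(1) by simp
  also have "pair_prod t (flip x S) S = pair_prod t (\<lambda>i. inverse (x i)) S"
    by (intro pair_prod_cong) (auto simp: flip_def)
  also have "pair_prod t (flip x S) (A - S) = pair_prod t x (A - S)"
    by (intro pair_prod_cong) (auto simp: flip_def)
  also have "(\<Prod>i\<in>S. \<Prod>j\<in>A - S. (1 - t * (flip x S i * flip x S j)) / (1 - flip x S i * flip x S j))
      = hl_cross t x S (A - S)"
    unfolding hl_cross_def using assms by (intro prod.cong refl) (auto simp: flip_def inverse_factor)
  finally show ?thesis unfolding B_kernel_def 1 by (simp only: mult_ac)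
qed

lemma hl_star_B_kernel:
  fixes x :: "nat \<Rightarrow> 'a::field"
  assumes "B_generic x A"
  shows "hl_star t x (B_kernel t t2 (\<lambda>i. inverse (x i))) (B_kernel t t2 x) A = qpoch (- t2) t (card A)"
proof -
  have "hl_star t x (B_kernel t t2 (\<lambda>i. inverse (x i))) (B_kernel t t2 x) A
      = (\<Sum>S\<in>Pow A. B_kernel t t2 (flip x S) A)"
    unfolding hl_star_def using assms
    by (intro sum.cong refl B_kernel_flip[symmetric]) (auto simp: B_generic_def)
  then show ?thesis using sum_B_kernel_flip[OF assms] by simp
qed

lemma prod_sign:
  fixes g :: "'i \<Rightarrow> 'a::comm_ring_1"
  assumes "finite A" "S \<subseteq> A" "\<And>i. i \<in> S \<Longrightarrow> f i = - g i" "\<And>i. i \<in> A - S \<Longrightarrow> f i = g i"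
  shows "(\<Prod>i\<in>A. f i) = (- 1) ^ card S * (\<Prod>i\<in>A. g i)"
proof -
  have A: "(\<Prod>i\<in>A. h i) = (\<Prod>i\<in>A - S. h i) * (\<Prod>i\<in>S. h i)" for h :: "'i \<Rightarrow> 'a"
    using assms(1,2) by (intro prod.subset_diff) auto
  have "(\<Prod>i\<in>S. f i) = (\<Prod>i\<in>S. - g i)" "(\<Prod>i\<in>A - S. f i) = (\<Prod>i\<in>A - S. g i)"
    using assms by (auto intro: prod.cong)
  then show ?thesis by (simp add: A prod_uminus mult_ac)
qed

text \<open>For \<open>t2 = - 1\<close> the factor \<open>(1 - t2 * y) / (1 - y)\<close> is odd under inversion of \<open>y\<close>, and the
  right-hand side of \<open>sum_B_kernel_flip\<close> vanishes.\<close>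

lemma alternating_sum_pair_prod:
  fixes x :: "nat \<Rightarrow> 'a::field"
  assumes gen: "B_generic x A" and "A \<noteq> {}"
  shows "(\<Sum>S\<in>Pow A. (- 1) ^ card S * pair_prod t (flip x S) A) = 0"
proof (cases "\<exists>k\<in>A. x k = - 1")
  case True
  then obtain k where k: "k \<in> A" "x k = - 1" by auto
  define A' where "A' = A - {k}"
  have fin: "finite A" using gen by (simp add: B_generic_def)
  have A: "A = insert k A'" "k \<notin> A'" "finite A'" using k fin by (auto simp: A'_def)
  have "(\<Sum>S\<in>Pow A. (- 1) ^ card S * pair_prod t (flip x S) A) = (\<Sum>S\<in>Pow A'.
      (- 1) ^ card S * pair_prod t (flip x S) A
      + (- 1) ^ card (insert k S) * pair_prod t (flip x (insert k S)) A)"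
    by (subst (1) A(1), rule sum_Pow_insert) (use A in auto)
  also have "\<dots> = 0"
  proof (rule sum.neutral, intro ballI)
    fix S assume "S \<in> Pow A'"
    then have "k \<notin> S" "finite S" using A finite_subset by auto
    \<comment> \<open>The value - 1 is its own inverse, so inverting the variable k changes only the
      sign in front.\<close>
    moreover have "flip x (insert k S) = flip x S" using k by (auto simp: flip_def fun_eq_iff)
    ultimately show "(- 1) ^ card S * pair_prod t (flip x S) A
      + (- 1) ^ card (insert k S) * pair_prod t (flip x (insert k S)) A = 0" by simp
  qed
  finally show ?thesis .
next
  case False
  have fin: "finite A" and nz: "\<And>i. i \<in> A \<Longrightarrow> x i \<noteq> 0" and n1: "\<And>i. i \<in> A \<Longrightarrow> x i \<noteq> 1"
    using gen by (auto simp: B_generic_def)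
  \<comment> \<open>This common factor is divided out at the end; it is nonzero only if no variable
    is - 1, which is why that value was treated first.\<close>
  define c where "c = (\<Prod>i\<in>A. (1 + x i) / (1 - x i))"
  have "(1 + x i) / (1 - x i) \<noteq> 0" if "i \<in> A" for i
    using False n1 that by (auto simp: add_eq_0_iff)
  then have "c \<noteq> 0" unfolding c_def using fin by (simp add: prod_zero_iff)
  have "qpoch 1 t (card A) = 0" unfolding qpoch_def using fin \<open>A \<noteq> {}\<close>
    by (intro prod_zero) (auto intro: bexI[of _ 0] simp: card_gt_0_iff)
  then have "0 = (\<Sum>S\<in>Pow A. B_kernel t (- 1) (flip x S) A)"
    using sum_B_kernel_flip[OF gen, of t "- 1"] by simp
  also have "\<dots> = (\<Sum>S\<in>Pow A. c * ((- 1) ^ card S * pair_prod t (flip x S) A))"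
  proof (rule sum.cong)
    fix S assume S: "S \<in> Pow A"
    have "(\<Prod>i\<in>A. (1 - - 1 * flip x S i) / (1 - flip x S i)) = (- 1) ^ card S * c"
      unfolding c_def
    proof (rule prod_sign[OF fin])
      fix i assume i: "i \<in> S"
      then have "x i \<noteq> 0" "x i \<noteq> 1" using S nz n1 by auto
      then show "(1 - - 1 * flip x S i) / (1 - flip x S i) = - ((1 + x i) / (1 - x i))"
        using i by (simp add: flip_def divide_simps) (simp add: algebra_simps)
    qed (use S in \<open>auto simp: flip_def\<close>)
    then show "B_kernel t (- 1) (flip x S) A = c * ((- 1) ^ card S * pair_prod t (flip x S) A)"
      by (simp add: B_kernel_def mult_ac)
  qed simp
  finally show ?thesis using \<open>c \<noteq> 0\<close> by (simp add: sum_distrib_left[symmetric])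
qed

lemma B_kernel_factor: "B_kernel t t2 y A = (\<Prod>i\<in>A. 1 - t2 * y i) * B_kernel t 0 y A"
  unfolding B_kernel_def by (simp add: prod_dividef)

text \<open>Inverting x in 1 / (1 - x) and multiplying by 1/x gives - 1 / (1 - x). So the
  one-variable factors contribute a common product and a sign per inverted variable, and the
  alternating sum of \<open>pair_prod\<close> remains.\<close>

lemma hl_star_B_kernel_delta:
  fixes x :: "nat \<Rightarrow> 'a::field"
  assumes gen: "B_generic x A"
  shows "hl_star t x (\<lambda>B. (\<Prod>i\<in>B. inverse (x i)) * B_kernel t 0 (\<lambda>i. inverse (x i)) B) (B_kernel t 0 x) A
       = (if A = {} then 1 else 0)"
proof (cases "A = {}")
  case True
  then show ?thesis by (simp add: hl_star_def B_kernel_def)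
next
  case False
  have fin: "finite A" and nz: "\<And>i. i \<in> A \<Longrightarrow> x i \<noteq> 0" and n1: "\<And>i. i \<in> A \<Longrightarrow> x i \<noteq> 1"
    using gen by (auto simp: B_generic_def)
  have "hl_star t x (\<lambda>B. (\<Prod>i\<in>B. inverse (x i)) * B_kernel t 0 (\<lambda>i. inverse (x i)) B) (B_kernel t 0 x) A
      = (\<Sum>S\<in>Pow A. (\<Prod>i\<in>A. 1 / (1 - x i)) * ((- 1) ^ card S * pair_prod t (flip x S) A))"
    unfolding hl_star_def
  proof (rule sum.cong)
    fix S assume S: "S \<in> Pow A"
    then have "(\<Prod>i\<in>S. inverse (x i)) = (\<Prod>i\<in>A. if i \<in> S then inverse (x i) else 1)"
      using fin by (simp add: prod.If_cases Int_absorb1)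
    then have "(\<Prod>i\<in>S. inverse (x i)) * (\<Prod>i\<in>A. (1 - 0 * flip x S i) / (1 - flip x S i))
        = (\<Prod>i\<in>A. (if i \<in> S then inverse (x i) else 1) * ((1 - 0 * flip x S i) / (1 - flip x S i)))"
      by (simp only: prod.distrib)
    also have "\<dots> = (- 1) ^ card S * (\<Prod>i\<in>A. 1 / (1 - x i))"
    proof (rule prod_sign[OF fin])
      fix i assume i: "i \<in> S"
      then have "x i \<noteq> 0" "x i \<noteq> 1" using S nz n1 by auto
      then show "(if i \<in> S then inverse (x i) else 1) * ((1 - 0 * flip x S i) / (1 - flip x S i))
          = - (1 / (1 - x i))"
        using i by (simp add: flip_def divide_simps)
    qed (use S in \<open>auto simp: flip_def\<close>)
    finally have sign: "(\<Prod>i\<in>S. inverse (x i)) * (\<Prod>i\<in>A. (1 - 0 * flip x S i) / (1 - flip x S i))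
        = (- 1) ^ card S * (\<Prod>i\<in>A. 1 / (1 - x i))" .
    have 1: "(\<Prod>i\<in>S. inverse (x i)) * B_kernel t 0 (flip x S) A
        = (\<Prod>i\<in>A. 1 / (1 - x i)) * ((- 1) ^ card S * pair_prod t (flip x S) A)"
      unfolding B_kernel_def mult.assoc[symmetric] sign by (simp only: mult_ac)
    show "(\<Prod>i\<in>S. inverse (x i)) * B_kernel t 0 (\<lambda>i. inverse (x i)) S * B_kernel t 0 x (A - S)
        * hl_cross t x S (A - S) = (\<Prod>i\<in>A. 1 / (1 - x i)) * ((- 1) ^ card S * pair_prod t (flip x S) A)"
      unfolding 1[symmetric] using S fin nz by (subst B_kernel_flip) (auto simp: mult_ac)
  qed simp
  also have "\<dots> = 0"
    unfolding sum_distrib_left[symmetric] using alternating_sum_pair_prod[OF gen False] by simp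
  finally show ?thesis using False by simp
qed

text \<open>Both sides are compared after right multiplication by \<open>B_kernel t 0 x\<close>,
  which may be cancelled. At t2 = 0 the product with the left-hand side is the constant 1, since all
  factors of \<open>qpoch 0 t\<close> are 1; on the right-hand side the last two factors collapse to
  the unit.\<close>

lemma B_kernel_eq_hl_star:
  fixes x :: "nat \<Rightarrow> 'a::field"
  assumes gen: "B_generic x A"
  shows "B_kernel t 0 (\<lambda>i. inverse (x i)) A
       = hl_star t x (\<lambda>_. 1) (\<lambda>B. (\<Prod>i\<in>B. inverse (x i)) * B_kernel t 0 (\<lambda>i. inverse (x i)) B) A"
    (is "?D A = hl_star t x _ ?D' A")
proof (rule hl_star_right_cancel[of A "B_kernel t 0 x" t x])
  show "finite A" using gen by (simp add: B_generic_def)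
  show "B_kernel t 0 x {} = 1" by (simp add: B_kernel_def)
  fix B assume "B \<subseteq> A"
  then have genB: "B_generic x B" using gen by (rule B_generic_subset[rotated])
  then have fin: "finite B" by (simp add: B_generic_def)
  have "hl_star t x (hl_star t x (\<lambda>_. 1) ?D') (B_kernel t 0 x) B
      = hl_star t x (\<lambda>_. 1) (\<lambda>C. if C = {} then 1 else 0) B"
    unfolding hl_star_assoc[OF fin]
    by (intro hl_star_cong hl_star_B_kernel_delta B_generic_subset[OF genB] refl)
  also have "\<dots> = 1" by (rule hl_star_unit_right[OF fin])
  also have "\<dots> = hl_star t x ?D (B_kernel t 0 x) B"
    using hl_star_B_kernel[OF genB, of t 0] by (simp add: qpoch_def)
  finally show "hl_star t x ?D (B_kernel t 0 x) B = hl_star t x (hl_star t x (\<lambda>_. 1) ?D') (B_kernel t 0 x) B" ..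
qed simp

text \<open>The parameter t2 enters the kernel at inverted variables only through the product of 1 -
  t2 / x_i, which the monomial turns into the product of x_i - t2. That product is multiplicative
  over blocks, so it can be spread over both factors of the t2 = 0 identity, where x_i - t2 times 1
  / x_i restores the kernel for t2.\<close>

lemma monomial_times_B_kernel:
  fixes x :: "nat \<Rightarrow> 'a::field"
  assumes gen: "B_generic x A"
  shows "(\<Prod>i\<in>A. x i) * B_kernel t t2 (\<lambda>i. inverse (x i)) A
       = hl_star t x (\<lambda>B. \<Prod>i\<in>B. x i + - t2) (B_kernel t t2 (\<lambda>i. inverse (x i))) A"
proof -
  have fin: "finite A" and nz: "\<And>i. i \<in> A \<Longrightarrow> x i \<noteq> 0" using gen by (auto simp: B_generic_def)
  have shift: "(\<Prod>i\<in>B. x i) * (\<Prod>i\<in>B. 1 - t2 * inverse (x i)) = (\<Prod>i\<in>B. x i - t2)"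
    "(\<Prod>i\<in>B. inverse (x i)) * (\<Prod>i\<in>B. x i) = 1" if "B \<subseteq> A" for B
    unfolding prod.distrib[symmetric] using that nz
    by (auto intro!: prod.cong prod.neutral simp: field_simps)
  have "(\<Prod>i\<in>A. x i) * B_kernel t t2 (\<lambda>i. inverse (x i)) A
      = ((\<Prod>i\<in>A. x i) * (\<Prod>i\<in>A. 1 - t2 * inverse (x i))) * B_kernel t 0 (\<lambda>i. inverse (x i)) A"
    by (subst B_kernel_factor) (simp only: mult_ac)
  also have "\<dots> = (\<Prod>i\<in>A. x i - t2) * hl_star t x (\<lambda>_. 1)
      (\<lambda>B. (\<Prod>i\<in>B. inverse (x i)) * B_kernel t 0 (\<lambda>i. inverse (x i)) B) A"
    unfolding shift(1)[OF subset_refl] by (subst B_kernel_eq_hl_star[OF gen]) simp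
  also have "\<dots> = hl_star t x (\<lambda>B. (\<Prod>i\<in>B. x i - t2) * 1)
      (\<lambda>B. (\<Prod>i\<in>B. x i - t2) * ((\<Prod>i\<in>B. inverse (x i)) * B_kernel t 0 (\<lambda>i. inverse (x i)) B)) A"
    by (rule hl_star_multiplicative[OF fin, symmetric])
  also have "\<dots> = hl_star t x (\<lambda>B. \<Prod>i\<in>B. x i + - t2) (B_kernel t t2 (\<lambda>i. inverse (x i))) A"
  proof (rule hl_star_cong)
    fix B assume B: "B \<subseteq> A"
    have "(\<Prod>i\<in>B. x i - t2) * ((\<Prod>i\<in>B. inverse (x i)) * B_kernel t 0 (\<lambda>i. inverse (x i)) B)
        = ((\<Prod>i\<in>B. inverse (x i)) * (\<Prod>i\<in>B. x i)) * ((\<Prod>i\<in>B. 1 - t2 * inverse (x i)) * B_kernel t 0 (\<lambda>i. inverse (x i)) B)"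
      unfolding shift(1)[OF B, symmetric] by (simp only: mult_ac)
    then show "(\<Prod>i\<in>B. x i - t2) * ((\<Prod>i\<in>B. inverse (x i)) * B_kernel t 0 (\<lambda>i. inverse (x i)) B)
        = B_kernel t t2 (\<lambda>i. inverse (x i)) B"
      by (simp only: shift(2)[OF B] mult_1_left B_kernel_factor[of t t2])
  qed simp
  finally show ?thesis .
qed

section \<open>Sums over permutations\<close>

lemma prod_lessThan_add:
  "(\<Prod>i<a + b. f i) = (\<Prod>i<a. f i) * (\<Prod>i<b. f (a + i))" for f :: "nat \<Rightarrow> 'a::comm_monoid_mult"
  by (induction b) (simp_all add: mult.assoc)

text \<open>Permutations are encoded as enumerations of the variable set, so that the summand makes
  sense for every finite set of variables and splitting into blocks is concatenation of
  lists.\<close>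

definition perm_kernel :: "'a::field \<Rightarrow> ('i \<Rightarrow> 'a) \<Rightarrow> nat list \<Rightarrow> 'i list \<Rightarrow> 'a" where
  "perm_kernel t x \<mu> xs = (\<Prod>i<length \<mu>. x (xs ! i) ^ (\<mu> ! i)) *
     (\<Prod>j<length \<mu>. \<Prod>i<j. (x (xs ! i) - t * x (xs ! j)) / (x (xs ! i) - x (xs ! j)))"

definition perm_sum :: "'a::field \<Rightarrow> ('i \<Rightarrow> 'a) \<Rightarrow> nat list \<Rightarrow> 'i set \<Rightarrow> 'a" where
  "perm_sum t x \<mu> A = (\<Sum>xs\<in>permutations_of_set A. perm_kernel t x \<mu> xs)"

lemma perm_kernel_append:
  fixes x :: "'b \<Rightarrow> 'a::field"
  assumes "length ys = length \<mu>" "length zs = length \<nu>" "distinct ys" "distinct zs"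
  shows "perm_kernel t x (\<mu> @ \<nu>) (ys @ zs)
       = perm_kernel t x \<mu> ys * perm_kernel t x \<nu> zs * hl_cross t x (set ys) (set zs)"
proof -
  let ?a = "length \<mu>" and ?b = "length \<nu>" and ?f = "\<lambda>i j. (x i - t * x j) / (x i - x j)"
  have set_prod: "(\<Prod>i<length us. h (us ! i)) = (\<Prod>i\<in>set us. h i)" if "distinct us"
    for us and h :: "'b \<Rightarrow> 'a"
    using that by (intro prod.reindex_bij_betw bij_betw_nth) auto
  have "hl_cross t x (set ys) (set zs) = (\<Prod>i<?a. \<Prod>j<?b. ?f (ys ! i) (zs ! j))"
    unfolding hl_cross_def set_prod[OF assms(3), symmetric] set_prod[OF assms(4), symmetric] assms(1,2) ..
  also have "\<dots> = (\<Prod>j<?b. \<Prod>i<?a. ?f (ys ! i) (zs ! j))" by (rule prod.swap)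
  finally have cross: "hl_cross t x (set ys) (set zs) = (\<Prod>j<?b. \<Prod>i<?a. ?f (ys ! i) (zs ! j))" .
  have l: "(ys @ zs) ! i = ys ! i" "(\<mu> @ \<nu>) ! i = \<mu> ! i" if "i < ?a" for i
    using that assms by (auto simp: nth_append)
  have r: "(ys @ zs) ! (?a + i) = zs ! i" "(\<mu> @ \<nu>) ! (?a + i) = \<nu> ! i" for i
    using assms by (auto simp: nth_append)
  have "(\<Prod>i<?a. x ((ys @ zs) ! i) ^ ((\<mu> @ \<nu>) ! i)) = (\<Prod>i<?a. x (ys ! i) ^ (\<mu> ! i))"
    by (intro prod.cong) (auto simp: l)
  moreover have "(\<Prod>j<?a. \<Prod>i<j. ?f ((ys @ zs) ! i) ((ys @ zs) ! j)) = (\<Prod>j<?a. \<Prod>i<j. ?f (ys ! i) (ys ! j))"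
    by (intro prod.cong) (auto simp: l)
  moreover have "(\<Prod>j<?b. \<Prod>i<?a. ?f ((ys @ zs) ! i) (zs ! j)) = (\<Prod>j<?b. \<Prod>i<?a. ?f (ys ! i) (zs ! j))"
    by (intro prod.cong) (auto simp: l)
  ultimately show ?thesis
    unfolding perm_kernel_def length_append prod_lessThan_add r prod.distrib cross
    by (simp only: mult_ac)
qed

text \<open>Enumerations of A are grouped by the set B of their leading entries; the two pieces are
  then enumerated independently, and the pairs that straddle the cut contribute a factor depending
  on B alone. The order of the parts is irrelevant here.\<close>

lemma perm_sum_append:
  assumes "finite A" "length \<mu> + length \<nu> = card A"
  shows "perm_sum t x (\<mu> @ \<nu>) A = (\<Sum>B | B \<subseteq> A \<and> card B = length \<mu>.
           perm_sum t x \<mu> B * perm_sum t x \<nu> (A - B) * hl_cross t x B (A - B))"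
proof -
  let ?I = "{B. B \<subseteq> A \<and> card B = length \<mu>}"
  let ?P = "\<lambda>B. permutations_of_set B \<times> permutations_of_set (A - B)"
  have fin: "finite B" if "B \<subseteq> A" for B using that assms(1) by (rule finite_subset)
  have "perm_sum t x (\<mu> @ \<nu>) A = (\<Sum>(B, ys, zs)\<in>Sigma ?I ?P.
      perm_kernel t x \<mu> ys * perm_kernel t x \<nu> zs * hl_cross t x B (A - B))"
    unfolding perm_sum_def
  proof (rule sum.reindex_bij_witness[where i = "\<lambda>(B, ys, zs). ys @ zs"
        and j = "\<lambda>xs. (set (take (length \<mu>) xs), take (length \<mu>) xs, drop (length \<mu>) xs)"])
    fix xs assume "xs \<in> permutations_of_set A"
    then have xs: "set xs = A" "distinct xs" by (auto dest: permutations_of_setD)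
    define ys zs where "ys = take (length \<mu>) xs" and "zs = drop (length \<mu>) xs"
    have "length xs = card A" using xs distinct_card by metis
    then have len: "length ys = length \<mu>" "length zs = length \<nu>"
      using assms(2) by (auto simp: ys_def zs_def)
    have app: "xs = ys @ zs" by (simp add: ys_def zs_def)
    then have dist: "distinct ys" "distinct zs" "set ys \<inter> set zs = {}" "A = set ys \<union> set zs"
      using xs by auto
    then have zs: "set zs = A - set ys" by auto
    have "(set ys, ys, zs) \<in> Sigma ?I ?P"
    proof (intro SigmaI)
      show "set ys \<in> ?I" using dist(4) len(1) distinct_card[OF dist(1)] by simp
    qed (use dist(1,2) zs in \<open>auto intro!: permutations_of_setI\<close>)
    then show "(set (take (length \<mu>) xs), take (length \<mu>) xs, drop (length \<mu>) xs) \<in> Sigma ?I ?P"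
      by (simp add: ys_def zs_def)
    have "perm_kernel t x \<mu> ys * perm_kernel t x \<nu> zs * hl_cross t x (set ys) (A - set ys)
        = perm_kernel t x (\<mu> @ \<nu>) xs"
      unfolding app zs[symmetric] by (rule perm_kernel_append[symmetric]) (use len dist in auto)
    then show "(case (set (take (length \<mu>) xs), take (length \<mu>) xs, drop (length \<mu>) xs) of
        (B, ys, zs) \<Rightarrow> perm_kernel t x \<mu> ys * perm_kernel t x \<nu> zs * hl_cross t x B (A - B))
        = perm_kernel t x (\<mu> @ \<nu>) xs" by (simp add: ys_def zs_def)
  next
    fix p assume "p \<in> Sigma ?I ?P"
    then obtain B ys zs where p: "p = (B, ys, zs)" "B \<subseteq> A" "card B = length \<mu>"
        "set ys = B" "distinct ys" "set zs = A - B" "distinct zs"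
      by (auto simp: permutations_of_set_def)
    then have len: "length ys = length \<mu>" using distinct_card by metis
    then show "(\<lambda>xs. (set (take (length \<mu>) xs), take (length \<mu>) xs, drop (length \<mu>) xs))
        ((\<lambda>(B, ys, zs). ys @ zs) p) = p" using p by simp
    show "(\<lambda>(B, ys, zs). ys @ zs) p \<in> permutations_of_set A"
      using p by (auto intro!: permutations_of_setI)
  qed auto
  also have "\<dots> = (\<Sum>B\<in>?I. \<Sum>(ys, zs)\<in>?P B. perm_kernel t x \<mu> ys * perm_kernel t x \<nu> zs * hl_cross t x B (A - B))"
    using assms(1) by (subst sum.Sigma) auto
  also have "\<dots> = (\<Sum>B\<in>?I. perm_sum t x \<mu> B * perm_sum t x \<nu> (A - B) * hl_cross t x B (A - B))"
    unfolding perm_sum_def sum_product sum.cartesian_product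
    by (intro sum.cong refl) (simp add: sum_distrib_right case_prod_unfold)
  finally show ?thesis .
qed

text \<open>Choosing the leading variable splits off a singleton block, and
  \<open>sum_prod_cross_eq_geometric\<close> says that this choice contributes (1 - t^n) / (1 - t)
  when there are n variables.\<close>

lemma perm_sum_replicate_0:
  fixes x :: "'i \<Rightarrow> 'a::field"
  assumes "finite A" "card A = n" "inj_on x A" "\<And>i. i \<in> A \<Longrightarrow> x i \<noteq> 0" "t \<noteq> 1 \<or> n = 0"
  shows "perm_sum t x (replicate n 0) A = qpoch t t n / (1 - t) ^ n"
  using assms
proof (induction n arbitrary: A)
  case 0
  then show ?case by (simp add: perm_sum_def perm_kernel_def qpoch_def)
next
  case (Suc n)
  then have t: "t \<noteq> 1" by simp
  have "perm_sum t x ([0] @ replicate n 0) A = (\<Sum>B | B \<subseteq> A \<and> card B = 1.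
      perm_sum t x [0] B * perm_sum t x (replicate n 0) (A - B) * hl_cross t x B (A - B))"
    using Suc.prems by (subst perm_sum_append) auto
  also have "{B. B \<subseteq> A \<and> card B = 1} = (\<lambda>k. {k}) ` A"
    by (auto simp: card_1_singleton_iff)
  also have "(\<Sum>B\<in>(\<lambda>k. {k}) ` A.
      perm_sum t x [0] B * perm_sum t x (replicate n 0) (A - B) * hl_cross t x B (A - B))
    = (\<Sum>k\<in>A. perm_sum t x [0] {k} * perm_sum t x (replicate n 0) (A - {k}) * hl_cross t x {k} (A - {k}))"
    by (subst sum.reindex) auto
  also have "\<dots> = (\<Sum>k\<in>A. qpoch t t n / (1 - t) ^ n * (\<Prod>j\<in>A - {k}. (x k - t * x j) / (x k - x j)))"
  proof (rule sum.cong)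
    fix k assume k: "k \<in> A"
    have "perm_sum t x (replicate n 0) (A - {k}) = qpoch t t n / (1 - t) ^ n"
      using Suc.prems k t by (intro Suc.IH) (auto intro: inj_on_subset)
    then show "perm_sum t x [0] {k} * perm_sum t x (replicate n 0) (A - {k}) * hl_cross t x {k} (A - {k})
        = qpoch t t n / (1 - t) ^ n * (\<Prod>j\<in>A - {k}. (x k - t * x j) / (x k - x j))"
      by (simp add: hl_cross_def perm_sum_def perm_kernel_def)
  qed simp
  also have "\<dots> = qpoch t t n / (1 - t) ^ n * (\<Sum>i<Suc n. t ^ i)"
    unfolding sum_distrib_left[symmetric] using Suc.prems
    by (subst sum_prod_cross_eq_geometric) auto
  also have "(\<Sum>i<Suc n. t ^ i) = (1 - t ^ Suc n) / (1 - t)"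
    using t one_diff_power_eq[of t "Suc n"] by (simp add: field_simps)
  finally show ?case using t by (simp add: qpoch_def)
qed

lemma perm_sum_replicate:
  fixes x :: "'i \<Rightarrow> 'a::field"
  assumes "finite A" "card A = n" "inj_on x A" "\<And>i. i \<in> A \<Longrightarrow> x i \<noteq> 0" "t \<noteq> 1 \<or> n = 0"
  shows "perm_sum t x (replicate n a) A = (\<Prod>i\<in>A. x i ^ a) * (qpoch t t n / (1 - t) ^ n)"
proof -
  have "perm_kernel t x (replicate n a) xs = (\<Prod>i\<in>A. x i ^ a) * perm_kernel t x (replicate n 0) xs"
    if "xs \<in> permutations_of_set A" for xs
  proof -
    have xs: "set xs = A" "distinct xs" using that by (auto dest: permutations_of_setD)
    then have len: "length xs = n" using assms(2) distinct_card by metis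
    have "(\<Prod>i<n. x (xs ! i) ^ (replicate n a ! i)) = (\<Prod>i<n. x (xs ! i) ^ a)"
      by (intro prod.cong) auto
    also have "\<dots> = (\<Prod>i\<in>A. x i ^ a)"
      unfolding len[symmetric] xs(1)[symmetric]
      by (rule prod.reindex_bij_betw[OF bij_betw_nth]) (use xs in auto)
    finally show ?thesis by (simp add: perm_kernel_def)
  qed
  then have "perm_sum t x (replicate n a) A = (\<Prod>i\<in>A. x i ^ a) * perm_sum t x (replicate n 0) A"
    unfolding perm_sum_def sum_distrib_left by (intro sum.cong) auto
  then show ?thesis using perm_sum_replicate_0[OF assms] by simp
qed

lemma sum_permutes_eq_perm_sum:
  assumes "length \<mu> = n"
  shows "(\<Sum>w | w permutes {..<n}. HL_kernel n \<mu> t (x \<circ> w)) = perm_sum t x \<mu> {..<n}"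
  unfolding perm_sum_def
proof (rule sum.reindex_bij_witness[where i = "\<lambda>xs i. if i < n then xs ! i else i"
      and j = "\<lambda>w. map w [0..<n]"])
  fix w assume "w \<in> {w. w permutes {..<n}}"
  then have w: "w permutes {..<n}" by simp
  show "(\<lambda>i. if i < n then map w [0..<n] ! i else i) = w"
    using permutes_not_in[OF w] by (auto simp: fun_eq_iff)
  show "map w [0..<n] \<in> permutations_of_set {..<n}"
    using permutes_image[OF w] permutes_inj_on[OF w]
    by (auto intro!: permutations_of_setI simp: distinct_map atLeast0LessThan)
  show "perm_kernel t x \<mu> (map w [0..<n]) = HL_kernel n \<mu> t (x \<circ> w)"
    unfolding perm_kernel_def HL_kernel_def assms by simp
next
  fix xs assume "xs \<in> permutations_of_set {..<n}"
  then have xs: "set xs = {..<n}" "distinct xs" by (auto dest: permutations_of_setD)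
  then have len: "length xs = n" using distinct_card[of xs] by simp
  show "map (\<lambda>i. if i < n then xs ! i else i) [0..<n] = xs"
    using len by (intro nth_equalityI) auto
  have "bij_betw (\<lambda>i. xs ! i) {..<n} {..<n}"
    by (rule bij_betw_nth[OF xs(2)]) (simp_all add: len xs(1))
  then have "bij_betw (\<lambda>i. if i < n then xs ! i else i) {..<n} {..<n}"
    by (rule bij_betw_cong[THEN iffD1, rotated]) auto
  then show "(\<lambda>i. if i < n then xs ! i else i) \<in> {w. w permutes {..<n}}"
    by (intro CollectI bij_imp_permutes) auto
qed

section \<open>Removing the largest part of a partition\<close>

lemma qpoch_Suc: "qpoch a t (Suc n) = qpoch a t n * (1 - a * t ^ n)"
  by (simp add: qpoch_def)

lemma qpoch_nonzero:
  fixes t :: "'a::field"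
  assumes "\<And>k. 1 \<le> k \<Longrightarrow> k \<le> n \<Longrightarrow> t ^ k \<noteq> 1" "j \<le> n"
  shows "qpoch t t j \<noteq> 0"
  unfolding qpoch_def using assms(1)[of "Suc _"] assms(2)
  by (auto simp: prod_zero_iff eq_commute[of 1])

lemma sum_Pow_card:
  assumes "finite A"
  shows "(\<Sum>B\<in>Pow A. f B) = (\<Sum>j\<le>card A. \<Sum>B | B \<subseteq> A \<and> card B = j. f B)"
proof -
  have "(\<Sum>j\<le>card A. \<Sum>B | B \<in> Pow A \<and> card B = j. f B) = (\<Sum>B\<in>Pow A. f B)"
    using assms by (intro sum.group) (auto intro: card_mono)
  then show ?thesis by simp
qed

definition qbinomial :: "'a::field \<Rightarrow> nat \<Rightarrow> nat \<Rightarrow> 'a" where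
  "qbinomial t n j = qpoch t t n / (qpoch t t j * qpoch t t (n - j))"

text \<open>The symmetrisation of a constant is evaluated twice, directly and after cutting the zero
  exponents into j and n - j. The powers of 1 - t cancel in the quotient, leaving the q-binomial
  coefficient.\<close>

lemma sum_hl_cross_card:
  fixes x :: "'i \<Rightarrow> 'a::field"
  assumes "finite A" "inj_on x A" "\<And>i. i \<in> A \<Longrightarrow> x i \<noteq> 0"
    and t: "\<And>k. 1 \<le> k \<Longrightarrow> k \<le> card A \<Longrightarrow> t ^ k \<noteq> 1" and "j \<le> card A"
  shows "(\<Sum>B | B \<subseteq> A \<and> card B = j. hl_cross t x B (A - B)) = qbinomial t (card A) j"
proof (cases "card A = 0")
  case True
  then have "A = {}" "j = 0" using assms by auto
  moreover have "{B. B \<subseteq> ({} :: 'i set) \<and> card B = 0} = {{}}" by auto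
  ultimately show ?thesis by (simp add: qbinomial_def qpoch_def)
next
  case False
  then have t1: "t \<noteq> 1" using t[of 1] by simp
  define n where "n = card A"
  let ?v = "\<lambda>k. qpoch t t k / (1 - t) ^ k"
  have "?v n = perm_sum t x (replicate j 0 @ replicate (n - j) 0) A"
    using perm_sum_replicate_0[of A n x t] assms t1 by (simp add: n_def replicate_add[symmetric])
  also have "\<dots> = (\<Sum>B | B \<subseteq> A \<and> card B = j.
      perm_sum t x (replicate j 0) B * perm_sum t x (replicate (n - j) 0) (A - B) * hl_cross t x B (A - B))"
    using assms by (subst perm_sum_append) (auto simp: n_def)
  also have "\<dots> = (\<Sum>B | B \<subseteq> A \<and> card B = j. ?v j * ?v (n - j) * hl_cross t x B (A - B))"
  proof (rule sum.cong)
    fix B assume "B \<in> {B. B \<subseteq> A \<and> card B = j}"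
    then have B: "B \<subseteq> A" "card B = j" by auto
    have "perm_sum t x (replicate j 0) B = ?v j"
      using B assms t1 by (intro perm_sum_replicate_0) (auto intro: finite_subset inj_on_subset)
    moreover have "perm_sum t x (replicate (n - j) 0) (A - B) = ?v (n - j)"
      using B assms t1 by (intro perm_sum_replicate_0)
        (auto simp: n_def card_Diff_subset finite_subset intro: inj_on_subset)
    ultimately show "perm_sum t x (replicate j 0) B * perm_sum t x (replicate (n - j) 0) (A - B)
        * hl_cross t x B (A - B) = ?v j * ?v (n - j) * hl_cross t x B (A - B)" by simp
  qed simp
  finally have "?v n = ?v j * ?v (n - j) * (\<Sum>B | B \<subseteq> A \<and> card B = j. hl_cross t x B (A - B))"
    by (simp add: sum_distrib_left)
  moreover have "(1 - t) ^ n = (1 - t) ^ j * (1 - t) ^ (n - j)"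
    using assms by (simp add: n_def flip: power_add)
  moreover have "qpoch t t j \<noteq> 0" "qpoch t t (n - j) \<noteq> 0"
    using qpoch_nonzero[OF t, of j] qpoch_nonzero[OF t, of "card A - j"] assms(5) by (auto simp: n_def)
  ultimately show ?thesis using t1 unfolding n_def[symmetric] by (simp add: qbinomial_def field_simps)
qed

text \<open>Functions of the cardinality form a subalgebra; in it the product is the convolution of
  generating functions with denominators \<open>qpoch t t j\<close>.\<close>

lemma hl_star_card:
  fixes x :: "'i \<Rightarrow> 'a::field"
  assumes "finite A" "inj_on x A" "\<And>i. i \<in> A \<Longrightarrow> x i \<noteq> 0"
    and t: "\<And>k. 1 \<le> k \<Longrightarrow> k \<le> card A \<Longrightarrow> t ^ k \<noteq> 1"
  shows "hl_star t x (\<lambda>B. a (card B)) (\<lambda>C. b (card C)) A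
       = (\<Sum>j\<le>card A. a j * b (card A - j) * qbinomial t (card A) j)"
  unfolding hl_star_def sum_Pow_card[OF assms(1)]
proof (rule sum.cong)
  fix j assume j: "j \<in> {..card A}"
  have "(\<Sum>B | B \<subseteq> A \<and> card B = j. a (card B) * b (card (A - B)) * hl_cross t x B (A - B))
      = (\<Sum>B | B \<subseteq> A \<and> card B = j. a j * b (card A - j) * hl_cross t x B (A - B))"
    using assms(1) by (intro sum.cong) (auto simp: card_Diff_subset finite_subset)
  also have "\<dots> = a j * b (card A - j) * qbinomial t (card A) j"
    unfolding sum_distrib_left[symmetric] using assms j by (subst sum_hl_cross_card) auto
  finally show "(\<Sum>B | B \<subseteq> A \<and> card B = j. a (card B) * b (card (A - B)) * hl_cross t x B (A - B))
      = a j * b (card A - j) * qbinomial t (card A) j" .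
qed simp

text \<open>The coefficient of u^n in a product of two cases of the q-binomial theorem: the series
  are 1 / (zu;t)_inf and (zu;t)_inf / (u;t)_inf, and their product is 1 / (u;t)_inf. The proof uses
  only the first-order recurrences of the coefficients.\<close>

lemma sum_qpoch_convolution:
  fixes t z :: "'a::field"
  assumes "\<And>k. 1 \<le> k \<Longrightarrow> k \<le> n \<Longrightarrow> t ^ k \<noteq> 1"
  shows "(\<Sum>j\<le>n. z ^ j / qpoch t t j * (qpoch z t (n - j) / qpoch t t (n - j))) = 1 / qpoch t t n"
  using assms
proof (induction n)
  case 0
  then show ?case by (simp add: qpoch_def)
next
  case (Suc n)
  define a where "a j = z ^ j / qpoch t t j" for j
  define b where "b d = qpoch z t d / qpoch t t d" for d
  have tk: "1 - t * t ^ k \<noteq> 0" if "k \<le> n" for k using Suc.prems[of "Suc k"] that by auto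
  have b_Suc: "b (Suc d) * (1 - t ^ Suc d) = b d * (1 - z * t ^ d)" if "d \<le> n" for d
    using tk[OF that] by (simp add: b_def qpoch_Suc)
  have a_Suc: "a (Suc d) * (1 - t ^ Suc d) = a d * z" if "d \<le> n" for d
    using tk[OF that] by (simp add: a_def qpoch_Suc)
  \<comment> \<open>Split 1 - t^(n+1) as (1 - t^(n+1-j)) + t^(n+1-j) (1 - t^j): the first part
    lowers the index of b, the second that of a, and the two terms containing z then cancel.\<close>
  have "(1 - t ^ Suc n) * (\<Sum>j\<le>Suc n. a j * b (Suc n - j))
      = (\<Sum>j\<le>Suc n. a j * (b (Suc n - j) * (1 - t ^ (Suc n - j))))
        + (\<Sum>j\<le>Suc n. a j * (1 - t ^ j) * (t ^ (Suc n - j) * b (Suc n - j)))"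
    unfolding sum_distrib_left sum.distrib[symmetric]
  proof (rule sum.cong)
    fix j assume "j \<in> {..Suc n}"
    then have "t ^ Suc n = t ^ j * t ^ (Suc n - j)" by (simp flip: power_add)
    then show "(1 - t ^ Suc n) * (a j * b (Suc n - j)) = a j * (b (Suc n - j) * (1 - t ^ (Suc n - j)))
        + a j * (1 - t ^ j) * (t ^ (Suc n - j) * b (Suc n - j))"
      by (simp only: algebra_simps) simp
  qed simp
  also have "(\<Sum>j\<le>Suc n. a j * (b (Suc n - j) * (1 - t ^ (Suc n - j))))
      = (\<Sum>j\<le>n. a j * (b (n - j) * (1 - z * t ^ (n - j))))"
    unfolding sum.atMost_Suc by (simp only: diff_self_eq_0 power_0 diff_self mult_zero_right add_0_right)
      (intro sum.cong refl, simp add: Suc_diff_le b_Suc[symmetric])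
  also have "(\<Sum>j\<le>Suc n. a j * (1 - t ^ j) * (t ^ (Suc n - j) * b (Suc n - j)))
      = (\<Sum>j\<le>n. a j * z * (t ^ (n - j) * b (n - j)))"
    unfolding sum.atMost_Suc_shift by (simp only: power_0 diff_self mult_zero_right mult_zero_left add_0_left)
      (intro sum.cong refl, simp only: a_Suc atMost_iff diff_Suc_Suc)
  also have "(\<Sum>j\<le>n. a j * (b (n - j) * (1 - z * t ^ (n - j)))) + (\<Sum>j\<le>n. a j * z * (t ^ (n - j) * b (n - j)))
      = (\<Sum>j\<le>n. a j * b (n - j))"
    unfolding sum.distrib[symmetric] by (intro sum.cong refl) (simp add: algebra_simps)
  also have "\<dots> = 1 / qpoch t t n"
    unfolding a_def b_def using Suc.prems by (intro Suc.IH) auto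
  finally have "(\<Sum>j\<le>Suc n. a j * b (Suc n - j)) = 1 / qpoch t t n / (1 - t ^ Suc n)"
    using tk[of n] by (subst eq_divide_eq) (simp_all add: mult.commute)
  then show ?case by (simp only: a_def b_def qpoch_Suc power_Suc divide_divide_eq_left)
qed

section \<open>Weighted sums over partitions, peeled at the largest part\<close>

definition level_sum :: "(nat \<Rightarrow> nat \<Rightarrow> 'a::field) \<Rightarrow> 'a \<Rightarrow> ('i \<Rightarrow> 'a) \<Rightarrow> nat \<Rightarrow> 'i set \<Rightarrow> 'a" where
  "level_sum w t x k A = (\<Sum>\<mu>\<in>partitions_in_box (card A) k.
     (\<Prod>i\<le>k. w i (count_list \<mu> i)) * (perm_sum t x \<mu> A / v_part \<mu> t))"

lemma finite_partitions_in_box: "finite (partitions_in_box n m)"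
proof (rule finite_subset)
  show "partitions_in_box n m \<subseteq> {\<mu>. set \<mu> \<subseteq> {..m} \<and> length \<mu> = n}"
    by (auto simp: partitions_in_box_def)
  show "finite {\<mu>. set \<mu> \<subseteq> {..m} \<and> length \<mu> = n}" by (rule finite_lists_length_eq) simp
qed

lemma sorted_wrt_ge_replicate: "sorted_wrt (\<ge>) (replicate n (a :: 'b::order))"
  by (induction n) auto

lemma partitions_in_box_0: "partitions_in_box n 0 = {replicate n 0}"
  by (auto simp: partitions_in_box_def sorted_wrt_ge_replicate intro!: replicate_eqI)

text \<open>Parts decrease weakly, so the copies of the largest admissible part form a prefix, of
  length j; the value j = 0 accounts for the partitions in the smaller box.\<close>

lemma sum_partitions_in_box_Suc:
  "(\<Sum>\<mu>\<in>partitions_in_box n (Suc k). f \<mu>)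
     = (\<Sum>j\<le>n. \<Sum>\<nu>\<in>partitions_in_box (n - j) k. f (replicate j (Suc k) @ \<nu>))"
proof -
  have "(\<Sum>\<mu>\<in>partitions_in_box n (Suc k). f \<mu>)
      = (\<Sum>(j, \<nu>)\<in>Sigma {..n} (\<lambda>j. partitions_in_box (n - j) k). f (replicate j (Suc k) @ \<nu>))"
  proof (rule sum.reindex_bij_witness[where i = "\<lambda>(j, \<nu>). replicate j (Suc k) @ \<nu>"
        and j = "\<lambda>\<mu>. (length (takeWhile (\<lambda>i. i = Suc k) \<mu>), dropWhile (\<lambda>i. i = Suc k) \<mu>)"])
    fix \<mu> assume \<mu>: "\<mu> \<in> partitions_in_box n (Suc k)"
    define ys zs where "ys = takeWhile (\<lambda>i. i = Suc k) \<mu>" and "zs = dropWhile (\<lambda>i. i = Suc k) \<mu>"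
    have app: "\<mu> = ys @ zs" by (simp add: ys_def zs_def)
    have ys: "ys = replicate (length ys) (Suc k)"
      unfolding ys_def by (intro replicate_eqI) (auto dest: set_takeWhileD)
    have len: "length ys + length zs = n" and sorted: "sorted_wrt (\<ge>) zs" and le: "\<forall>i\<in>set zs. i \<le> Suc k"
      using \<mu> unfolding app by (auto simp: partitions_in_box_def sorted_wrt_append)
    have "i \<le> k" if "i \<in> set zs" for i
    proof (cases zs)
      case Nil
      then show ?thesis using that by simp
    next
      case (Cons a as)
      then have "a \<noteq> Suc k" using hd_dropWhile[of "\<lambda>i. i = Suc k" \<mu>] by (simp add: zs_def)
      then have "a \<le> k" using le Cons by auto
      then show ?thesis using that sorted Cons by auto
    qed
    then have zs: "zs \<in> partitions_in_box (n - length ys) k"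
      using len sorted by (auto simp: partitions_in_box_def)
    show "(length (takeWhile (\<lambda>i. i = Suc k) \<mu>), dropWhile (\<lambda>i. i = Suc k) \<mu>)
        \<in> Sigma {..n} (\<lambda>j. partitions_in_box (n - j) k)"
      using zs len by (auto simp: ys_def zs_def)
    show "(\<lambda>(j, \<nu>). replicate j (Suc k) @ \<nu>)
        (length (takeWhile (\<lambda>i. i = Suc k) \<mu>), dropWhile (\<lambda>i. i = Suc k) \<mu>) = \<mu>"
      using ys app unfolding ys_def zs_def by simp
    then show "(case (length (takeWhile (\<lambda>i. i = Suc k) \<mu>), dropWhile (\<lambda>i. i = Suc k) \<mu>) of
        (j, \<nu>) \<Rightarrow> f (replicate j (Suc k) @ \<nu>)) = f \<mu>" by simp
  next
    fix p assume "p \<in> Sigma {..n} (\<lambda>j. partitions_in_box (n - j) k)"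
    then obtain j \<nu> where p: "p = (j, \<nu>)" "j \<le> n" "length \<nu> = n - j" "sorted_wrt (\<ge>) \<nu>" "\<forall>i\<in>set \<nu>. i \<le> k"
      by (auto simp: partitions_in_box_def)
    have "takeWhile (\<lambda>i. i = Suc k) \<nu> = []" "dropWhile (\<lambda>i. i = Suc k) \<nu> = \<nu>"
      using p(5) by (cases \<nu>; auto)+
    then have "takeWhile (\<lambda>i. i = Suc k) (replicate j (Suc k) @ \<nu>) = replicate j (Suc k)"
        "dropWhile (\<lambda>i. i = Suc k) (replicate j (Suc k) @ \<nu>) = \<nu>"
      by (induction j) auto
    then show "(\<lambda>\<mu>. (length (takeWhile (\<lambda>i. i = Suc k) \<mu>), dropWhile (\<lambda>i. i = Suc k) \<mu>))
        ((\<lambda>(j, \<nu>). replicate j (Suc k) @ \<nu>) p) = p" using p by simp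
    have "sorted_wrt (\<ge>) (replicate j (Suc k))" by (simp add: sorted_wrt_ge_replicate)
    then show "(\<lambda>(j, \<nu>). replicate j (Suc k) @ \<nu>) p \<in> partitions_in_box n (Suc k)"
      using p by (fastforce simp: partitions_in_box_def sorted_wrt_append)
  qed
  then show ?thesis by (subst sum.Sigma) (auto simp: finite_partitions_in_box)
qed

lemma v_part_replicate_append:
  assumes "a \<notin> set \<nu>"
  shows "v_part (replicate j a @ \<nu>) t = qpoch t t j / (1 - t) ^ j * v_part \<nu> t"
proof -
  have count: "count_list (replicate j a @ \<nu>) a = j" "i \<noteq> a \<Longrightarrow> count_list (replicate j a @ \<nu>) i = count_list \<nu> i" for i
    using assms by (induction j) (auto simp: count_list_0_iff)
  have rest: "(\<Prod>i\<in>set \<nu>. qpoch t t (count_list (replicate j a @ \<nu>) i) / (1 - t) ^ count_list (replicate j a @ \<nu>) i)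
      = v_part \<nu> t"
    unfolding v_part_def using assms by (intro prod.cong refl) (metis count(2))
  show ?thesis
  proof (cases "j = 0")
    case True
    then show ?thesis by (simp add: qpoch_def)
  next
    case False
    then have "set (replicate j a @ \<nu>) = insert a (set \<nu>)" by simp
    then have "v_part (replicate j a @ \<nu>) t = qpoch t t j / (1 - t) ^ j
        * (\<Prod>i\<in>set \<nu>. qpoch t t (count_list (replicate j a @ \<nu>) i) / (1 - t) ^ count_list (replicate j a @ \<nu>) i)"
      unfolding v_part_def using assms by (simp only: prod.insert finite_set count not_False_eq_True)
    then show ?thesis unfolding rest .
  qed
qed

lemma level_sum_0:
  fixes x :: "'i \<Rightarrow> 'a::field"
  assumes "finite A" "inj_on x A" "\<And>i. i \<in> A \<Longrightarrow> x i \<noteq> 0"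
    and t: "\<And>k. 1 \<le> k \<Longrightarrow> k \<le> card A \<Longrightarrow> t ^ k \<noteq> 1"
  shows "level_sum w t x 0 A = w 0 (card A)"
proof -
  define n where "n = card A"
  have t1: "t \<noteq> 1 \<or> n = 0" using t[of 1] by (cases "card A = 0") (auto simp: n_def Suc_le_eq)
  have "v_part (replicate n (0::nat)) t = qpoch t t n / (1 - t) ^ n"
    using v_part_replicate_append[of "0::nat" "[]" n t] by (simp add: v_part_def)
  moreover have "perm_sum t x (replicate n 0) A = qpoch t t n / (1 - t) ^ n"
    using assms t1 by (intro perm_sum_replicate_0) (auto simp: n_def)
  moreover have "qpoch t t n / (1 - t) ^ n \<noteq> 0"
    using t1 qpoch_nonzero[OF t, of n] by (auto simp: n_def)
  moreover have "count_list (replicate n (0::nat)) 0 = n" by (induction n) auto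
  ultimately show ?thesis by (auto simp: level_sum_def partitions_in_box_0 n_def[symmetric])
qed

text \<open>\<open>perm_sum_append\<close> detaches the block of parts \<open>Suc k\<close>. Its
  symmetrised sum is the monomial times exactly the factor that the block contributes to
  \<open>v_part\<close>, so the normalisations cancel.\<close>

lemma level_sum_Suc:
  fixes x :: "'i \<Rightarrow> 'a::field"
  assumes "finite A" "inj_on x A" "\<And>i. i \<in> A \<Longrightarrow> x i \<noteq> 0"
    and t: "\<And>k. 1 \<le> k \<Longrightarrow> k \<le> card A \<Longrightarrow> t ^ k \<noteq> 1"
  shows "level_sum w t x (Suc k) A
       = hl_star t x (\<lambda>B. (\<Prod>i\<in>B. x i ^ Suc k) * w (Suc k) (card B)) (level_sum w t x k) A"
proof -
  define n where "n = card A"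
  have t1: "t \<noteq> 1 \<or> n = 0" using t[of 1] by (cases "card A = 0") (auto simp: n_def Suc_le_eq)
  have "level_sum w t x (Suc k) A = (\<Sum>j\<le>n. \<Sum>\<nu>\<in>partitions_in_box (n - j) k.
     (\<Prod>i\<le>Suc k. w i (count_list (replicate j (Suc k) @ \<nu>) i))
     * (perm_sum t x (replicate j (Suc k) @ \<nu>) A / v_part (replicate j (Suc k) @ \<nu>) t))"
    unfolding level_sum_def sum_partitions_in_box_Suc n_def ..
  also have "\<dots> = (\<Sum>j\<le>n. \<Sum>B | B \<subseteq> A \<and> card B = j. (\<Prod>i\<in>B. x i ^ Suc k) * w (Suc k) (card B)
      * level_sum w t x k (A - B) * hl_cross t x B (A - B))"
  proof (rule sum.cong)
    fix j assume "j \<in> {..n}"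
    then have j: "j \<le> n" by simp
    let ?v = "qpoch t t j / (1 - t) ^ j"
    have v: "?v \<noteq> 0" using t1 qpoch_nonzero[OF t, of j] j by (auto simp: n_def)
    have "(\<Prod>i\<le>Suc k. w i (count_list (replicate j (Suc k) @ \<nu>) i))
       * (perm_sum t x (replicate j (Suc k) @ \<nu>) A / v_part (replicate j (Suc k) @ \<nu>) t)
       = (\<Sum>B | B \<subseteq> A \<and> card B = j. (\<Prod>i\<in>B. x i ^ Suc k) * w (Suc k) (card B) *
          ((\<Prod>i\<le>k. w i (count_list \<nu> i)) * (perm_sum t x \<nu> (A - B) / v_part \<nu> t)) * hl_cross t x B (A - B))"
      if \<nu>: "\<nu> \<in> partitions_in_box (n - j) k" for \<nu>
    proof -
      have len: "length \<nu> = n - j" and notin: "Suc k \<notin> set \<nu>"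
        using \<nu> by (auto simp: partitions_in_box_def)
      have count: "count_list (replicate j (Suc k) @ \<nu>) (Suc k) = j"
          "i \<le> k \<Longrightarrow> count_list (replicate j (Suc k) @ \<nu>) i = count_list \<nu> i" for i
        using notin by (induction j) (auto simp: count_list_0_iff)
      have W: "(\<Prod>i\<le>Suc k. w i (count_list (replicate j (Suc k) @ \<nu>) i))
          = (\<Prod>i\<le>k. w i (count_list \<nu> i)) * w (Suc k) j"
        unfolding prod.atMost_Suc count(1)
        by (intro arg_cong2[where f = "(*)"] prod.cong refl) (simp only: atMost_iff count(2))
      have "perm_sum t x (replicate j (Suc k) @ \<nu>) A = (\<Sum>B | B \<subseteq> A \<and> card B = j.
          perm_sum t x (replicate j (Suc k)) B * perm_sum t x \<nu> (A - B) * hl_cross t x B (A - B))"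
        using assms(1) j len by (subst perm_sum_append) (auto simp: n_def)
      also have "\<dots> = (\<Sum>B | B \<subseteq> A \<and> card B = j.
          (\<Prod>i\<in>B. x i ^ Suc k) * ?v * perm_sum t x \<nu> (A - B) * hl_cross t x B (A - B))"
      proof (rule sum.cong)
        fix B assume "B \<in> {B. B \<subseteq> A \<and> card B = j}"
        then have "perm_sum t x (replicate j (Suc k)) B = (\<Prod>i\<in>B. x i ^ Suc k) * ?v"
          using assms t1 j by (intro perm_sum_replicate) (auto intro: finite_subset inj_on_subset)
        then show "perm_sum t x (replicate j (Suc k)) B * perm_sum t x \<nu> (A - B) * hl_cross t x B (A - B)
            = (\<Prod>i\<in>B. x i ^ Suc k) * ?v * perm_sum t x \<nu> (A - B) * hl_cross t x B (A - B)" by (simp only:)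
      qed simp
      finally have P: "perm_sum t x (replicate j (Suc k) @ \<nu>) A = (\<Sum>B | B \<subseteq> A \<and> card B = j.
          (\<Prod>i\<in>B. x i ^ Suc k) * ?v * perm_sum t x \<nu> (A - B) * hl_cross t x B (A - B))" .
      show ?thesis
        unfolding W P v_part_replicate_append[OF notin] sum_divide_distrib sum_distrib_left
      proof (rule sum.cong)
        fix B assume "B \<in> {B. B \<subseteq> A \<and> card B = j}"
        then have "card B = j" by simp
        have cancel: "a * b / (a * c) = b / c" if "a \<noteq> 0" for a b c :: 'a using that by simp
        have "(\<Prod>i\<in>B. x i ^ Suc k) * ?v * perm_sum t x \<nu> (A - B) * hl_cross t x B (A - B) / (?v * v_part \<nu> t)
            = (\<Prod>i\<in>B. x i ^ Suc k) * perm_sum t x \<nu> (A - B) * hl_cross t x B (A - B) / v_part \<nu> t"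
          using cancel[OF v, of "(\<Prod>i\<in>B. x i ^ Suc k) * perm_sum t x \<nu> (A - B) * hl_cross t x B (A - B)"]
          by (simp only: mult_ac)
        then show "(\<Prod>i\<le>k. w i (count_list \<nu> i)) * w (Suc k) j * ((\<Prod>i\<in>B. x i ^ Suc k) * ?v
            * perm_sum t x \<nu> (A - B) * hl_cross t x B (A - B) / (?v * v_part \<nu> t))
          = (\<Prod>i\<in>B. x i ^ Suc k) * w (Suc k) (card B) * ((\<Prod>i\<le>k. w i (count_list \<nu> i))
            * (perm_sum t x \<nu> (A - B) / v_part \<nu> t)) * hl_cross t x B (A - B)"
          unfolding \<open>card B = j\<close> by (simp only: times_divide_eq_right times_divide_eq_left mult_ac)
      qed simp
    qed
    then have "(\<Sum>\<nu>\<in>partitions_in_box (n - j) k.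
       (\<Prod>i\<le>Suc k. w i (count_list (replicate j (Suc k) @ \<nu>) i))
       * (perm_sum t x (replicate j (Suc k) @ \<nu>) A / v_part (replicate j (Suc k) @ \<nu>) t))
      = (\<Sum>\<nu>\<in>partitions_in_box (n - j) k. \<Sum>B | B \<subseteq> A \<and> card B = j. (\<Prod>i\<in>B. x i ^ Suc k) * w (Suc k) (card B) *
          ((\<Prod>i\<le>k. w i (count_list \<nu> i)) * (perm_sum t x \<nu> (A - B) / v_part \<nu> t)) * hl_cross t x B (A - B))"
      by (intro sum.cong refl)
    also have "\<dots> = (\<Sum>B | B \<subseteq> A \<and> card B = j. \<Sum>\<nu>\<in>partitions_in_box (n - j) k. (\<Prod>i\<in>B. x i ^ Suc k) * w (Suc k) (card B) *
          ((\<Prod>i\<le>k. w i (count_list \<nu> i)) * (perm_sum t x \<nu> (A - B) / v_part \<nu> t)) * hl_cross t x B (A - B))"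
      by (rule sum.swap)
    also have "\<dots> = (\<Sum>B | B \<subseteq> A \<and> card B = j. (\<Prod>i\<in>B. x i ^ Suc k) * w (Suc k) (card B)
        * level_sum w t x k (A - B) * hl_cross t x B (A - B))"
    proof (rule sum.cong)
      fix B assume "B \<in> {B. B \<subseteq> A \<and> card B = j}"
      then have "card (A - B) = n - j" using assms(1) by (auto simp: card_Diff_subset finite_subset n_def)
      then show "(\<Sum>\<nu>\<in>partitions_in_box (n - j) k. (\<Prod>i\<in>B. x i ^ Suc k) * w (Suc k) (card B) *
          ((\<Prod>i\<le>k. w i (count_list \<nu> i)) * (perm_sum t x \<nu> (A - B) / v_part \<nu> t)) * hl_cross t x B (A - B))
        = (\<Prod>i\<in>B. x i ^ Suc k) * w (Suc k) (card B) * level_sum w t x k (A - B) * hl_cross t x B (A - B)"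
        unfolding level_sum_def by (simp only: sum_distrib_left sum_distrib_right)
    qed simp
    finally show "(\<Sum>\<nu>\<in>partitions_in_box (n - j) k.
       (\<Prod>i\<le>Suc k. w i (count_list (replicate j (Suc k) @ \<nu>) i))
       * (perm_sum t x (replicate j (Suc k) @ \<nu>) A / v_part (replicate j (Suc k) @ \<nu>) t))
      = (\<Sum>B | B \<subseteq> A \<and> card B = j. (\<Prod>i\<in>B. x i ^ Suc k) * w (Suc k) (card B)
        * level_sum w t x k (A - B) * hl_cross t x B (A - B))" .
  qed simp
  also have "\<dots> = hl_star t x (\<lambda>B. (\<Prod>i\<in>B. x i ^ Suc k) * w (Suc k) (card B)) (level_sum w t x k) A"
    unfolding hl_star_def n_def by (rule sum_Pow_card[OF assms(1), symmetric])
  finally show ?thesis .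
qed

section \<open>The B-type side F_m and the induction on the level\<close>

definition B_sum :: "'a::field \<Rightarrow> 'a \<Rightarrow> (nat \<Rightarrow> 'a) \<Rightarrow> nat \<Rightarrow> nat set \<Rightarrow> 'a" where
  "B_sum t t2 x m = hl_star t x (\<lambda>B. (\<Prod>i\<in>B. x i ^ m) * B_kernel t t2 (\<lambda>i. inverse (x i)) B) (B_kernel t t2 x)"

text \<open>The relation x D = x * Z * D is multiplied by x^m factor by factor and then by E from
  the right; associativity regroups x^m D with E into F_m.\<close>

lemma B_sum_Suc:
  fixes x :: "nat \<Rightarrow> 'a::field"
  assumes gen: "B_generic x A"
  shows "B_sum t t2 x (Suc m) A = hl_star t x (\<lambda>B. \<Prod>i\<in>B. x i ^ Suc m)
    (hl_star t x (\<lambda>B. (\<Prod>i\<in>B. x i ^ m) * (- t2) ^ card B) (B_sum t t2 x m)) A"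
proof -
  let ?D = "B_kernel t t2 (\<lambda>i. inverse (x i))" and ?Z = "\<lambda>B :: nat set. (- t2) ^ card B"
  have fin: "finite A" using gen by (simp add: B_generic_def)
  have key: "(\<Prod>i\<in>B. x i ^ Suc m) * ?D B = hl_star t x (\<lambda>C. \<Prod>i\<in>C. x i ^ Suc m)
      (hl_star t x (\<lambda>C. (\<Prod>i\<in>C. x i ^ m) * ?Z C) (\<lambda>C. (\<Prod>i\<in>C. x i ^ m) * ?D C)) B"
    if B: "B \<subseteq> A" for B
  proof -
    have genB: "B_generic x B" using gen B by (rule B_generic_subset)
    then have finB: "finite B" and inj: "inj_on x B" and nz: "\<And>i. i \<in> B \<Longrightarrow> x i \<noteq> 0"
      by (auto simp: B_generic_def)
    have "(\<Prod>i\<in>B. x i) * ?D B = hl_star t x (\<lambda>C. \<Prod>i\<in>C. x i + - t2) ?D B"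
      by (rule monomial_times_B_kernel[OF genB])
    also have "\<dots> = hl_star t x (hl_star t x (\<lambda>C. \<Prod>i\<in>C. x i) ?Z) ?D B"
    proof (rule hl_star_cong)
      fix C assume "C \<subseteq> B"
      then show "(\<Prod>i\<in>C. x i + - t2) = hl_star t x (\<lambda>C. \<Prod>i\<in>C. x i) ?Z C"
        using finB inj nz by (intro hl_star_monomial_power[symmetric]) (auto intro: finite_subset inj_on_subset)
    qed simp
    also have "\<dots> = hl_star t x (\<lambda>C. \<Prod>i\<in>C. x i) (hl_star t x ?Z ?D) B"
      by (rule hl_star_assoc[OF finB])
    finally have "(\<Prod>i\<in>B. x i ^ m) * ((\<Prod>i\<in>B. x i) * ?D B)
        = hl_star t x (\<lambda>C. (\<Prod>i\<in>C. x i ^ m) * (\<Prod>i\<in>C. x i)) (\<lambda>C. (\<Prod>i\<in>C. x i ^ m) * hl_star t x ?Z ?D C) B"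
      by (simp only: hl_star_multiplicative[OF finB])
    also have "\<dots> = hl_star t x (\<lambda>C. \<Prod>i\<in>C. x i ^ Suc m)
        (hl_star t x (\<lambda>C. (\<Prod>i\<in>C. x i ^ m) * ?Z C) (\<lambda>C. (\<Prod>i\<in>C. x i ^ m) * ?D C)) B"
    proof (rule hl_star_cong)
      fix C assume "C \<subseteq> B"
      then have "finite C" using finB by (rule finite_subset)
      then show "(\<Prod>i\<in>C. x i ^ m) * hl_star t x ?Z ?D C
          = hl_star t x (\<lambda>C. (\<Prod>i\<in>C. x i ^ m) * ?Z C) (\<lambda>C. (\<Prod>i\<in>C. x i ^ m) * ?D C) C"
        by (rule hl_star_multiplicative[symmetric])
    qed (simp add: prod.distrib mult.commute)
    finally show ?thesis by (simp add: prod.distrib mult_ac)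
  qed
  have "B_sum t t2 x (Suc m) A = hl_star t x (hl_star t x (\<lambda>C. \<Prod>i\<in>C. x i ^ Suc m)
      (hl_star t x (\<lambda>C. (\<Prod>i\<in>C. x i ^ m) * ?Z C) (\<lambda>C. (\<Prod>i\<in>C. x i ^ m) * ?D C))) (B_kernel t t2 x) A"
    unfolding B_sum_def by (intro hl_star_cong key refl)
  also have "\<dots> = hl_star t x (\<lambda>C. \<Prod>i\<in>C. x i ^ Suc m) (hl_star t x
      (hl_star t x (\<lambda>C. (\<Prod>i\<in>C. x i ^ m) * ?Z C) (\<lambda>C. (\<Prod>i\<in>C. x i ^ m) * ?D C)) (B_kernel t t2 x)) A"
    by (rule hl_star_assoc[OF fin])
  also have "\<dots> = hl_star t x (\<lambda>B. \<Prod>i\<in>B. x i ^ Suc m)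
    (hl_star t x (\<lambda>B. (\<Prod>i\<in>B. x i ^ m) * ?Z B) (B_sum t t2 x m)) A"
    unfolding B_sum_def using fin by (intro hl_star_cong hl_star_assoc refl) (rule finite_subset)
  finally show ?thesis .
qed

text \<open>At level 0, \<open>B_sum\<close> is \<open>qpoch (- t2) t\<close> of the cardinality,
  and \<open>sum_qpoch_convolution\<close> reduces its product with Z to the constant 1. In the step
  the weight of the new level is split as Z times the constant function 1; the latter combines with
  the old sum through \<open>B_sum_Suc\<close>, while Z stays outside.\<close>

lemma level_sum_eq:
  fixes x :: "nat \<Rightarrow> 'a::field"
  assumes "B_generic x A" and "\<And>k. 1 \<le> k \<Longrightarrow> k \<le> card A \<Longrightarrow> t ^ k \<noteq> 1"
    and "\<And>c. w 0 c = 1" and "\<And>i c. 1 \<le> i \<Longrightarrow> i \<le> k \<Longrightarrow> w i c = rogers_szego c (- t2) t"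
  shows "level_sum w t x k A
       = hl_star t x (\<lambda>B. (\<Prod>i\<in>B. x i ^ k) * (- t2) ^ card B) (B_sum t t2 x k) A"
  using assms
proof (induction k arbitrary: A)
  case 0
  then have fin: "finite A" and inj: "inj_on x A" and nz: "\<And>i. i \<in> A \<Longrightarrow> x i \<noteq> 0"
    by (auto simp: B_generic_def)
  have "qpoch t t (card A) \<noteq> 0" using qpoch_nonzero[OF 0(2), of "card A"] by simp
  have "hl_star t x (\<lambda>B. (\<Prod>i\<in>B. x i ^ 0) * (- t2) ^ card B) (B_sum t t2 x 0) A
      = hl_star t x (\<lambda>B. (- t2) ^ card B) (\<lambda>C. qpoch (- t2) t (card C)) A"
    unfolding B_sum_def using 0(1)
    by (intro hl_star_cong) (auto simp: hl_star_B_kernel B_generic_subset)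
  also have "\<dots> = (\<Sum>j\<le>card A. (- t2) ^ j * qpoch (- t2) t (card A - j) * qbinomial t (card A) j)"
    using fin inj nz 0(2) by (rule hl_star_card)
  also have "\<dots> = qpoch t t (card A) * (\<Sum>j\<le>card A.
      (- t2) ^ j / qpoch t t j * (qpoch (- t2) t (card A - j) / qpoch t t (card A - j)))"
    unfolding sum_distrib_left by (intro sum.cong refl) (simp add: qbinomial_def mult_ac)
  also have "\<dots> = 1" using sum_qpoch_convolution[OF 0(2)] \<open>qpoch t t (card A) \<noteq> 0\<close> by simp
  also have "1 = level_sum w t x 0 A"
    using level_sum_0[OF fin inj nz 0(2), of w] 0(3) by simp
  finally show ?case ..
next
  case (Suc k)
  then have fin: "finite A" and inj: "inj_on x A" and nz: "\<And>i. i \<in> A \<Longrightarrow> x i \<noteq> 0"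
    by (auto simp: B_generic_def)
  have IH: "level_sum w t x k B = hl_star t x (\<lambda>B. (\<Prod>i\<in>B. x i ^ k) * (- t2) ^ card B) (B_sum t t2 x k) B"
    if "B \<subseteq> A" for B
    using Suc.prems that fin card_mono[OF fin that]
    by (intro Suc.IH) (auto intro: B_generic_subset order.trans)
  have weight: "(\<Prod>i\<in>B. x i ^ Suc k) * w (Suc k) (card B)
      = hl_star t x (\<lambda>C. (\<Prod>i\<in>C. x i ^ Suc k) * (- t2) ^ card C) (\<lambda>C. \<Prod>i\<in>C. x i ^ Suc k) B"
    if B: "B \<subseteq> A" for B
  proof -
    have finB: "finite B" using B fin by (rule finite_subset)
    have "hl_star t x (\<lambda>C. (\<lambda>j. (- t2) ^ j) (card C)) (\<lambda>C. (\<lambda>_. 1) (card C)) B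
        = (\<Sum>j\<le>card B. (- t2) ^ j * 1 * qbinomial t (card B) j)"
      using B finB nz card_mono[OF fin B] Suc.prems(2)
      by (intro hl_star_card) (auto intro: inj_on_subset[OF inj])
    also have "\<dots> = w (Suc k) (card B)"
      using Suc.prems(4) by (simp add: rogers_szego_def qbinomial_def)
    finally show ?thesis
      using hl_star_multiplicative[OF finB, of t x "\<lambda>i. x i ^ Suc k" "\<lambda>C. (- t2) ^ card C" "\<lambda>_. 1"]
      by simp
  qed
  have "level_sum w t x (Suc k) A
      = hl_star t x (\<lambda>B. (\<Prod>i\<in>B. x i ^ Suc k) * w (Suc k) (card B)) (level_sum w t x k) A"
    using fin inj nz Suc.prems(2) by (rule level_sum_Suc)
  also have "\<dots> = hl_star t x (hl_star t x (\<lambda>C. (\<Prod>i\<in>C. x i ^ Suc k) * (- t2) ^ card C) (\<lambda>C. \<Prod>i\<in>C. x i ^ Suc k))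
      (hl_star t x (\<lambda>B. (\<Prod>i\<in>B. x i ^ k) * (- t2) ^ card B) (B_sum t t2 x k)) A"
    by (intro hl_star_cong weight IH)
  also have "\<dots> = hl_star t x (\<lambda>C. (\<Prod>i\<in>C. x i ^ Suc k) * (- t2) ^ card C) (hl_star t x (\<lambda>C. \<Prod>i\<in>C. x i ^ Suc k)
      (hl_star t x (\<lambda>B. (\<Prod>i\<in>B. x i ^ k) * (- t2) ^ card B) (B_sum t t2 x k))) A"
    by (rule hl_star_assoc[OF fin])
  also have "\<dots> = hl_star t x (\<lambda>C. (\<Prod>i\<in>C. x i ^ Suc k) * (- t2) ^ card C) (B_sum t t2 x (Suc k)) A"
    by (intro hl_star_cong refl B_sum_Suc[symmetric] B_generic_subset[OF Suc.prems(1)])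
  finally show ?case .
qed

lemma sum_h_part_hall_littlewood:
  fixes x :: "nat \<Rightarrow> 'a::field"
  assumes gen: "B_generic x {..<n}" and t: "\<And>k. 1 \<le> k \<Longrightarrow> k \<le> n \<Longrightarrow> t ^ k \<noteq> 1" and "m > 0"
  shows "(\<Sum>\<mu>\<in>partitions_in_box n m. h_part m \<mu> t2 t * hall_littlewood n \<mu> x t) = B_sum t t2 x m {..<n}"
proof -
  obtain k where m: "m = Suc k" using \<open>m > 0\<close> by (cases m) auto
  \<comment> \<open>\<open>h_part\<close> omits the multiplicities of 0 and m, so these levels get
    weight 1. Level m is therefore peeled off by hand, and \<open>level_sum_eq\<close> is used only
    up to k = m - 1.\<close>
  define w where "w i c = (if 1 \<le> i \<and> i < m then rogers_szego c (- t2) t else 1)" for i c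
  have inj: "inj_on x {..<n}" and nz: "\<And>i. i \<in> {..<n} \<Longrightarrow> x i \<noteq> 0"
    using gen by (auto simp: B_generic_def)
  have tn: "t ^ j \<noteq> 1" if "1 \<le> j" "j \<le> card {..<n}" for j using t that by simp
  have "(\<Sum>\<mu>\<in>partitions_in_box n m. h_part m \<mu> t2 t * hall_littlewood n \<mu> x t) = level_sum w t x m {..<n}"
    unfolding level_sum_def card_lessThan
  proof (rule sum.cong)
    fix \<mu> assume "\<mu> \<in> partitions_in_box n m"
    then have "length \<mu> = n" by (simp add: partitions_in_box_def)
    then have "hall_littlewood n \<mu> x t = perm_sum t x \<mu> {..<n} / v_part \<mu> t"
      by (simp add: hall_littlewood_def sum_permutes_eq_perm_sum)
    moreover have "(\<Prod>i\<le>m. w i (count_list \<mu> i)) = (\<Prod>i\<in>{1..<m}. w i (count_list \<mu> i))"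
      by (rule prod.mono_neutral_right) (auto simp: w_def)
    then have "(\<Prod>i\<le>m. w i (count_list \<mu> i)) = h_part m \<mu> t2 t"
      by (simp add: h_part_def w_def)
    ultimately show "h_part m \<mu> t2 t * hall_littlewood n \<mu> x t
        = (\<Prod>i\<le>m. w i (count_list \<mu> i)) * (perm_sum t x \<mu> {..<n} / v_part \<mu> t)" by simp
  qed simp
  also have "\<dots> = hl_star t x (\<lambda>B. (\<Prod>i\<in>B. x i ^ Suc k) * w (Suc k) (card B)) (level_sum w t x k) {..<n}"
    unfolding m by (rule level_sum_Suc[OF finite_lessThan inj nz tn])
  also have "\<dots> = hl_star t x (\<lambda>B. \<Prod>i\<in>B. x i ^ Suc k)
      (hl_star t x (\<lambda>B. (\<Prod>i\<in>B. x i ^ k) * (- t2) ^ card B) (B_sum t t2 x k)) {..<n}"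
  proof (rule hl_star_cong)
    fix B assume B: "B \<subseteq> {..<n}"
    then have "card B \<le> n" using card_mono[of "{..<n}" B] by simp
    then show "level_sum w t x k B
        = hl_star t x (\<lambda>B. (\<Prod>i\<in>B. x i ^ k) * (- t2) ^ card B) (B_sum t t2 x k) B"
      using t by (intro level_sum_eq B_generic_subset[OF gen B]) (auto simp: w_def m)
  qed (simp add: w_def m)
  also have "\<dots> = B_sum t t2 x m {..<n}"
    unfolding m by (rule B_sum_Suc[OF gen, symmetric])
  finally show ?thesis .
qed

lemma B_sum_eq_flip_sum:
  fixes x :: "nat \<Rightarrow> 'a::field"
  assumes "B_generic x A"
  shows "B_sum t t2 x m A = (\<Sum>S\<in>Pow A. (\<Prod>i\<in>S. x i ^ m) * B_kernel t t2 (flip x S) A)"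
  unfolding B_sum_def hl_star_def
proof (rule sum.cong)
  fix S assume "S \<in> Pow A"
  then show "(\<Prod>i\<in>S. x i ^ m) * B_kernel t t2 (\<lambda>i. inverse (x i)) S * B_kernel t t2 x (A - S) * hl_cross t x S (A - S)
      = (\<Prod>i\<in>S. x i ^ m) * B_kernel t t2 (flip x S) A"
    using assms by (subst B_kernel_flip) (auto simp: B_generic_def mult_ac)
qed simp

section \<open>The hyperoctahedral sum\<close>

text \<open>A permutation need not preserve the order of the indices, but by symmetry of the factors
  only the set of pairs counts.\<close>

lemma pair_prod_reindex:
  assumes "finite A" "inj_on \<sigma> A"
  shows "pair_prod t (y \<circ> \<sigma>) A = pair_prod t y (\<sigma> ` A)"
  using assms
proof (induction A rule: finite_induct)
  case (insert k A)
  then have "\<sigma> k \<notin> \<sigma> ` A" "inj_on \<sigma> A" by auto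
  then show ?case using insert by (simp add: pair_prod_insert prod.reindex)
qed simp

lemma half_pow_half:
  fixes q :: "'a::field"
  shows "half_pow q (rat_of_nat m / 2) = q ^ m" "half_pow q (- (rat_of_nat m / 2)) = inverse q ^ m"
proof -
  have "2 * (rat_of_nat m / 2) = of_int (int m)" "2 * - (rat_of_nat m / 2) = of_int (- int m)" by simp_all
  then have floor: "\<lfloor>2 * (rat_of_nat m / 2)\<rfloor> = int m" "\<lfloor>2 * - (rat_of_nat m / 2)\<rfloor> = - int m"
    by (simp_all only: floor_of_int)
  show "half_pow q (rat_of_nat m / 2) = q ^ m" "half_pow q (- (rat_of_nat m / 2)) = inverse q ^ m"
    unfolding half_pow_def floor by (simp_all add: power_int_minus power_inverse)
qed

text \<open>\<open>hyperoctahedral_act\<close> marks inversions by position, \<open>flip\<close> by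
  variable. The sets of marks correspond under the image by the permutation, so a reindexing for
  each permutation makes the inversions independent of it.\<close>

lemma sum_hyperoctahedral:
  "(\<Sum>w\<in>hyperoctahedral n. f (hyperoctahedral_act w r))
     = (\<Sum>S\<in>Pow {..<n}. \<Sum>\<sigma> | \<sigma> permutes {..<n}. f (flip r S \<circ> \<sigma>))"
proof -
  have "(\<Sum>w\<in>hyperoctahedral n. f (hyperoctahedral_act w r))
      = (\<Sum>\<sigma> | \<sigma> permutes {..<n}. \<Sum>S\<in>Pow {..<n}. f (hyperoctahedral_act (\<sigma>, S) r))"
    unfolding hyperoctahedral_def by (simp add: sum.cartesian_product)
  also have "\<dots> = (\<Sum>\<sigma> | \<sigma> permutes {..<n}. \<Sum>S\<in>Pow {..<n}. f (flip r S \<circ> \<sigma>))"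
  proof (rule sum.cong)
    fix \<sigma> assume "\<sigma> \<in> {\<sigma>. \<sigma> permutes {..<n}}"
    then have \<sigma>: "\<sigma> permutes {..<n}" by simp
    have "bij_betw ((`) \<sigma>) (Pow {..<n}) (Pow {..<n})"
      using permutes_imp_bij[OF \<sigma>] by (rule bij_betw_Pow)
    then have "(\<Sum>S\<in>Pow {..<n}. f (flip r S \<circ> \<sigma>)) = (\<Sum>S\<in>Pow {..<n}. f (flip r (\<sigma> ` S) \<circ> \<sigma>))"
      by (rule sum.reindex_bij_betw[symmetric])
    moreover have "flip r (\<sigma> ` S) \<circ> \<sigma> = hyperoctahedral_act (\<sigma>, S) r" for S
      using permutes_inj[OF \<sigma>] by (auto simp: flip_def hyperoctahedral_act_def fun_eq_iff inj_image_mem_iff)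
    ultimately show "(\<Sum>S\<in>Pow {..<n}. f (hyperoctahedral_act (\<sigma>, S) r)) = (\<Sum>S\<in>Pow {..<n}. f (flip r S \<circ> \<sigma>))"
      by simp
  qed simp
  also have "\<dots> = (\<Sum>S\<in>Pow {..<n}. \<Sum>\<sigma> | \<sigma> permutes {..<n}. f (flip r S \<circ> \<sigma>))" by (rule sum.swap)
  finally show ?thesis .
qed

text \<open>For a rectangular weight only the factors (t y_i - y_j) / (y_i - y_j) depend on the
  order of the variables. Written in u = 1/y they are the Hall-Littlewood factors (u_i - t u_j) /
  (u_i - u_j), so the sum over permutations is the symmetrisation of a constant.\<close>

lemma sum_permutes_PB_kernel:
  fixes q :: "nat \<Rightarrow> 'a::field"
  defines "y \<equiv> \<lambda>i. (q i)\<^sup>2"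
  assumes nz: "\<And>i. i < n \<Longrightarrow> y i \<noteq> 0" and inj: "inj_on y {..<n}" and t: "t \<noteq> 1 \<or> n = 0"
  shows "(\<Sum>\<sigma> | \<sigma> permutes {..<n}. PB_kernel n (replicate n (rat_of_nat m / 2)) t t2 (q \<circ> \<sigma>))
       = qpoch t t n / (1 - t) ^ n * ((\<Prod>i<n. inverse (q i) ^ m) * B_kernel t t2 y {..<n})"
proof -
  define u where "u i = inverse (y i)" for i
  have swap: "(t * a - b) * (1 - t * a * b) / ((a - b) * (1 - a * b))
      = (inverse a - t * inverse b) / (inverse a - inverse b) * ((1 - t * (a * b)) / (1 - a * b))"
    if "a \<noteq> 0" "b \<noteq> 0" for a b :: 'a
  proof -
    have "(inverse a - t * inverse b) / (inverse a - inverse b)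
        = ((b - t * a) / (a * b)) / ((b - a) / (a * b))"
      using that by (simp add: field_simps)
    also have "\<dots> = (b - t * a) / (b - a)" using that by simp
    also have "\<dots> = (t * a - b) / (a - b)"
      using minus_divide_divide[of "b - t * a" "b - a"] by simp
    finally show ?thesis by (simp add: mult.assoc)
  qed
  have "PB_kernel n (replicate n (rat_of_nat m / 2)) t t2 (q \<circ> \<sigma>)
      = HL_kernel n (replicate n 0) t (u \<circ> \<sigma>) * ((\<Prod>i<n. inverse (q i) ^ m) * B_kernel t t2 y {..<n})"
    if \<sigma>: "\<sigma> permutes {..<n}" for \<sigma>
  proof -
    have in_n: "\<sigma> i < n" if "i < n" for i using permutes_in_image[OF \<sigma>, of i] that by simp
    have perm: "(\<Prod>i<n. h (\<sigma> i)) = (\<Prod>i<n. h i)" for h :: "nat \<Rightarrow> 'a"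
      using prod.permute[OF \<sigma>, of h] by (simp add: comp_def)
    have "(\<Prod>i<n. half_pow ((q \<circ> \<sigma>) i) (- (replicate n (rat_of_nat m / 2) ! i))) = (\<Prod>i<n. inverse (q (\<sigma> i)) ^ m)"
      by (intro prod.cong) (auto simp: half_pow_half)
    also have "\<dots> = (\<Prod>i<n. inverse (q i) ^ m)" by (rule perm)
    finally have 1: "(\<Prod>i<n. half_pow ((q \<circ> \<sigma>) i) (- (replicate n (rat_of_nat m / 2) ! i)))
        = (\<Prod>i<n. inverse (q i) ^ m)" .
    have 2: "(\<Prod>i<n. (1 - t2 * ((q \<circ> \<sigma>) i)\<^sup>2) / (1 - ((q \<circ> \<sigma>) i)\<^sup>2)) = (\<Prod>i<n. (1 - t2 * y i) / (1 - y i))"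
      using perm[of "\<lambda>i. (1 - t2 * y i) / (1 - y i)"] by (simp add: y_def)
    have "(\<Prod>j<n. \<Prod>i<j. ((t * ((q \<circ> \<sigma>) i)\<^sup>2 - ((q \<circ> \<sigma>) j)\<^sup>2) * (1 - t * ((q \<circ> \<sigma>) i)\<^sup>2 * ((q \<circ> \<sigma>) j)\<^sup>2))
        / ((((q \<circ> \<sigma>) i)\<^sup>2 - ((q \<circ> \<sigma>) j)\<^sup>2) * (1 - ((q \<circ> \<sigma>) i)\<^sup>2 * ((q \<circ> \<sigma>) j)\<^sup>2)))
      = (\<Prod>j<n. \<Prod>i<j. ((u \<circ> \<sigma>) i - t * (u \<circ> \<sigma>) j) / ((u \<circ> \<sigma>) i - (u \<circ> \<sigma>) j)
          * ((1 - t * ((y \<circ> \<sigma>) i * (y \<circ> \<sigma>) j)) / (1 - (y \<circ> \<sigma>) i * (y \<circ> \<sigma>) j)))"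
    proof (intro prod.cong refl)
      fix i j assume "j \<in> {..<n}" "i \<in> {..<j}"
      then have "y (\<sigma> i) \<noteq> 0" "y (\<sigma> j) \<noteq> 0" using nz in_n by auto
      from swap[OF this] show "((t * ((q \<circ> \<sigma>) i)\<^sup>2 - ((q \<circ> \<sigma>) j)\<^sup>2) * (1 - t * ((q \<circ> \<sigma>) i)\<^sup>2 * ((q \<circ> \<sigma>) j)\<^sup>2))
        / ((((q \<circ> \<sigma>) i)\<^sup>2 - ((q \<circ> \<sigma>) j)\<^sup>2) * (1 - ((q \<circ> \<sigma>) i)\<^sup>2 * ((q \<circ> \<sigma>) j)\<^sup>2))
        = ((u \<circ> \<sigma>) i - t * (u \<circ> \<sigma>) j) / ((u \<circ> \<sigma>) i - (u \<circ> \<sigma>) j)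
          * ((1 - t * ((y \<circ> \<sigma>) i * (y \<circ> \<sigma>) j)) / (1 - (y \<circ> \<sigma>) i * (y \<circ> \<sigma>) j))"
        by (simp only: y_def u_def comp_def)
    qed
    also have "\<dots> = HL_kernel n (replicate n 0) t (u \<circ> \<sigma>) * pair_prod t (y \<circ> \<sigma>) {..<n}"
    proof -
      have "pair_prod t (y \<circ> \<sigma>) {..<n} = (\<Prod>j<n. \<Prod>i<j. (1 - t * ((y \<circ> \<sigma>) i * (y \<circ> \<sigma>) j)) / (1 - (y \<circ> \<sigma>) i * (y \<circ> \<sigma>) j))"
        unfolding pair_prod_def by (intro prod.cong refl) auto
      moreover have "HL_kernel n (replicate n 0) t (u \<circ> \<sigma>)
          = (\<Prod>j<n. \<Prod>i<j. ((u \<circ> \<sigma>) i - t * (u \<circ> \<sigma>) j) / ((u \<circ> \<sigma>) i - (u \<circ> \<sigma>) j))"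
        by (simp add: HL_kernel_def)
      ultimately show ?thesis by (simp only: prod.distrib)
    qed
    also have "pair_prod t (y \<circ> \<sigma>) {..<n} = pair_prod t y {..<n}"
      using pair_prod_reindex[of "{..<n}" \<sigma> t y] permutes_inj_on[OF \<sigma>] permutes_image[OF \<sigma>] by simp
    finally show ?thesis
      unfolding PB_kernel_def Let_def 1 2 B_kernel_def by (simp only: mult_ac)
  qed
  then have "(\<Sum>\<sigma> | \<sigma> permutes {..<n}. PB_kernel n (replicate n (rat_of_nat m / 2)) t t2 (q \<circ> \<sigma>))
      = (\<Sum>\<sigma> | \<sigma> permutes {..<n}. HL_kernel n (replicate n 0) t (u \<circ> \<sigma>))
        * ((\<Prod>i<n. inverse (q i) ^ m) * B_kernel t t2 y {..<n})"
    unfolding sum_distrib_right by (intro sum.cong) auto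
  also have "(\<Sum>\<sigma> | \<sigma> permutes {..<n}. HL_kernel n (replicate n 0) t (u \<circ> \<sigma>))
      = perm_sum t u (replicate n 0) {..<n}" by (rule sum_permutes_eq_perm_sum) simp
  also have "\<dots> = qpoch t t n / (1 - t) ^ n"
    using nz inj t by (intro perm_sum_replicate_0) (auto simp: u_def inj_on_def)
  finally show ?thesis .
qed

lemma B_generic_flip_inj:
  assumes "B_generic x A"
  shows "inj_on (flip x S) A"
proof (rule inj_onI)
  fix i j assume ij: "i \<in> A" "j \<in> A" "flip x S i = flip x S j"
  show "i = j"
  proof (rule ccontr)
    assume "i \<noteq> j"
    then have "x i \<noteq> x j" "x i * x j \<noteq> 1" "x i \<noteq> 0" "x j \<noteq> 0"
      using assms ij(1,2) by (auto simp: B_generic_def inj_on_def)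
    then show False using ij(3) by (auto simp: flip_def field_simps split: if_splits)
  qed
qed

lemma sum_hyperoctahedral_PB_kernel:
  fixes x r :: "nat \<Rightarrow> 'a::field"
  assumes gen: "B_generic x {..<n}" and sqrt: "\<And>i. i < n \<Longrightarrow> (r i)\<^sup>2 = x i" and t: "t \<noteq> 1 \<or> n = 0"
  shows "half_pow (\<Prod>i<n. r i) (rat_of_nat m / 2)
      * (\<Sum>w\<in>hyperoctahedral n. PB_kernel n (replicate n (rat_of_nat m / 2)) t t2 (hyperoctahedral_act w r))
    = qpoch t t n / (1 - t) ^ n * (\<Sum>S\<in>Pow {..<n}. (\<Prod>i\<in>S. x i ^ m) * B_kernel t t2 (flip x S) {..<n})"
  unfolding sum_hyperoctahedral sum_distrib_left[where A = "Pow {..<n}"]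
proof (rule sum.cong)
  fix S assume S: "S \<in> Pow {..<n}"
  define q where "q = flip r S"
  define y where "y i = (q i)\<^sup>2" for i
  have nz: "x i \<noteq> 0" if "i < n" for i using gen that by (auto simp: B_generic_def)
  have r_nz: "r i \<noteq> 0" if "i < n" for i using nz[OF that] sqrt[OF that] by auto
  have y: "y i = flip x S i" if "i < n" for i
    using sqrt[OF that] by (simp add: y_def q_def flip_def power_inverse)
  have "inj_on y {..<n} = inj_on (flip x S) {..<n}" by (rule inj_on_cong) (simp add: y)
  then have inj: "inj_on y {..<n}" using B_generic_flip_inj[OF gen] by simp
  have y_nz: "y i \<noteq> 0" if "i < n" for i using y[OF that] nz[OF that] by (simp add: flip_def)
  have ker: "B_kernel t t2 y {..<n} = B_kernel t t2 (flip x S) {..<n}"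
    by (rule B_kernel_cong) (simp add: y)
  \<comment> \<open>Outside S the powers of \<open>r i\<close> cancel; in S the inversion doubles
    them to r^(2m) = x^m. So half-integral powers disappear, and with them the choice of square
    roots.\<close>
  have "(\<Prod>i<n. r i) ^ m * (\<Prod>i<n. inverse (q i) ^ m) = (\<Prod>i<n. if i \<in> S then x i ^ m else 1)"
    unfolding prod_power_distrib prod.distrib[symmetric]
  proof (rule prod.cong)
    fix i assume "i \<in> {..<n}"
    then have "r i \<noteq> 0" "x i = r i * r i" using r_nz sqrt by (auto simp: power2_eq_square)
    then show "r i ^ m * inverse (q i) ^ m = (if i \<in> S then x i ^ m else 1)"
      by (simp add: q_def flip_def flip: power_mult_distrib)
  qed simp
  also have "\<dots> = (\<Prod>i\<in>S. x i ^ m)" using S by (simp add: prod.If_cases Int_absorb1)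
  finally have mono: "(\<Prod>i<n. r i) ^ m * (\<Prod>i<n. inverse (q i) ^ m) = (\<Prod>i\<in>S. x i ^ m)" .
  have "half_pow (\<Prod>i<n. r i) (rat_of_nat m / 2)
      * (\<Sum>\<sigma> | \<sigma> permutes {..<n}. PB_kernel n (replicate n (rat_of_nat m / 2)) t t2 (q \<circ> \<sigma>))
    = (\<Prod>i<n. r i) ^ m * (qpoch t t n / (1 - t) ^ n
        * ((\<Prod>i<n. inverse (q i) ^ m) * B_kernel t t2 y {..<n}))"
    using sum_permutes_PB_kernel[of n q t m t2] y_nz inj t unfolding half_pow_half y_def by simp
  also have "\<dots> = qpoch t t n / (1 - t) ^ n * ((\<Prod>i\<in>S. x i ^ m) * B_kernel t t2 (flip x S) {..<n})"
    unfolding ker mono[symmetric] by (simp only: mult_ac)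
  finally show "half_pow (\<Prod>i<n. r i) (rat_of_nat m / 2)
      * (\<Sum>\<sigma> | \<sigma> permutes {..<n}. PB_kernel n (replicate n (rat_of_nat m / 2)) t t2 (flip r S \<circ> \<sigma>))
    = qpoch t t n / (1 - t) ^ n * ((\<Prod>i\<in>S. x i ^ m) * B_kernel t t2 (flip x S) {..<n})"
    unfolding q_def .
qed simp

section \<open>Comparison of the normalisations\<close>

lemma v_part_replicate: "v_part (replicate n a) t = qpoch t t n / (1 - t) ^ n"
  using v_part_replicate_append[of a "[]" n t] by (simp add: v_part_def)

theorem theorem4p8:
  fixes n m :: nat
    and x r :: "nat \<Rightarrow> 'a::field_char_0"
    and t t2 :: 'a
  assumes sqrt: "\<And>i. i < n \<Longrightarrow> (r i)\<^sup>2 = x i"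
    and nonzero: "\<And>i. i < n \<Longrightarrow> x i \<noteq> 0"
    and ne_one: "\<And>i. i < n \<Longrightarrow> x i \<noteq> 1"
    and distinct: "\<And>i j. i < j \<Longrightarrow> j < n \<Longrightarrow> x i \<noteq> x j"
    and not_inverse: "\<And>i j. i < j \<Longrightarrow> j < n \<Longrightarrow> x i * x j \<noteq> 1"
    and t_generic: "\<And>k. 1 \<le> k \<Longrightarrow> k \<le> n \<Longrightarrow> t ^ k \<noteq> 1"
    and t2_generic: "qpoch (- t2) t (n - part_length (replicate n (rat_of_nat m / 2))) \<noteq> 0"
  shows "(\<Sum>\<mu>\<in>partitions_in_box n m. h_part m \<mu> t2 t * hall_littlewood n \<mu> x t)
       = half_pow (\<Prod>i<n. r i) (rat_of_nat m / 2)
         * PB n (replicate n (rat_of_nat m / 2)) r t t2"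
proof -
  have "x i \<noteq> x j" "x i * x j \<noteq> 1" if "i < n" "j < n" "i \<noteq> j" for i j
    using that distinct[of i j] distinct[of j i] not_inverse[of i j] not_inverse[of j i]
    by (cases i j rule: linorder_cases; force simp: mult.commute)+
  then have gen: "B_generic x {..<n}"
    unfolding B_generic_def inj_on_def using nonzero ne_one by auto
  have t1: "t \<noteq> 1 \<or> n = 0" using t_generic[of 1] by (cases "n = 0") (auto simp: Suc_le_eq)
  define v where "v = qpoch t t n / (1 - t) ^ n"
  have v: "v \<noteq> 0" using t1 qpoch_nonzero[OF t_generic, of n] by (auto simp: v_def)
  define c where "c = qpoch (- t2) t (n - part_length (replicate n (rat_of_nat m / 2)))"
  define F where "F = (\<Sum>S\<in>Pow {..<n}. (\<Prod>i\<in>S. x i ^ m) * B_kernel t t2 (flip x S) {..<n})"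
  have "half_pow (\<Prod>i<n. r i) (rat_of_nat m / 2) * (\<Sum>w\<in>hyperoctahedral n.
      PB_kernel n (replicate n (rat_of_nat m / 2)) t t2 (hyperoctahedral_act w r)) = v * F"
    unfolding v_def F_def by (rule sum_hyperoctahedral_PB_kernel[OF gen _ t1]) (rule sqrt)
  then have "half_pow (\<Prod>i<n. r i) (rat_of_nat m / 2) * PB n (replicate n (rat_of_nat m / 2)) r t t2
      = 1 / (c * v) * (v * F)"
    unfolding PB_def v_part_replicate c_def[symmetric] v_def[symmetric]
    by (subst mult.left_commute) simp
  also have "\<dots> = F / c" using v by simp
  also have "\<dots> = (\<Sum>\<mu>\<in>partitions_in_box n m. h_part m \<mu> t2 t * hall_littlewood n \<mu> x t)"
  proof (cases "m = 0")
    case True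
    \<comment> \<open>With all parts 0, the factor of \<open>PB\<close> with n - 0 terms is exactly
      the value of the sum over inversions, so both sides of the theorem are 1.\<close>
    then have "F = qpoch (- t2) t n" using sum_B_kernel_flip[OF gen, of t t2] by (simp add: F_def)
    moreover have "c = qpoch (- t2) t n" using True by (simp add: c_def part_length_def)
    ultimately have "F / c = 1" using t2_generic c_def by simp
    moreover have "hall_littlewood n (replicate n 0) x t = 1"
      using perm_sum_replicate_0[of "{..<n}" n x t] gen t1 v
      by (simp add: hall_littlewood_def sum_permutes_eq_perm_sum v_part_replicate B_generic_def v_def)
    ultimately show ?thesis using True by (simp add: partitions_in_box_0 h_part_def)
  next
    case False
    \<comment> \<open>All n parts m/2 are nonzero, so the factor with parameter - t2 is an empty
      product.\<close>
    then have "c = 1" by (simp add: c_def part_length_def qpoch_def)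
    then show ?thesis
      using False sum_h_part_hall_littlewood[OF gen t_generic, of m t2] B_sum_eq_flip_sum[OF gen, of t t2 m]
      by (simp add: F_def)
  qed
  finally show ?thesis ..
qed

end
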